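(* Let $d\ge 3$ be an integer. Let $f\in L^1_{\mathrm{loc}}([0,\infty))$ if $d$ is odd, and let $f\in L^p_{\mathrm{loc}}([0,\infty))$ for some $p>2$ if $d$ is even. Let $F$ be defined by $$F(s)=c_d\int_0^1 f(ts)(1-t^2)^{\frac{d-3}{2}}\,\mathrm{d}t = c_d\,\frac1s\int_0^s f(t)\Big(1-\frac{t^2}{s^2}\Big)^{\frac{d-3}{2}}\,\mathrm{d}t,\qquad s>0.$$ Then $F$ is $\lfloor \frac{d-2}{2}\rfloor$-times continuously differentiable on $(0,\infty)$. Moreover, if $d$ is odd, then the $\lfloor\frac{d-2}{2}\rfloor$-th derivative of $F$ is absolutely continuous on every compact subinterval of $(0,\infty)$. This result is optimal in the sense that (for every integer $d\ge 3$) there exists a function $f\in L^\infty_{\mathrm{loc}}([0,\infty))$ such that the corresponding $F$ is not $\lfloor \frac d2\rfloor$ times differentiable on $(0,\infty)$.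
   Context: $c_d:=\frac{2\omega_{d-2}}{\omega_{d-1}}$, where $\omega_{d-1}=\frac{2\pi^{d/2}}{\Gamma(d/2)}$ is the surface measure of the unit sphere $\mathbb S^{d-1}\subset\mathbb R^d$. $L^p_{\mathrm{loc}}([0,\infty))$ denotes the functions that are $p$-integrable on every bounded interval $[0,b]$, $b>0$, and $L^\infty_{\mathrm{loc}}([0,\infty))$ the functions that are bounded on every such interval. *)

theory Defs
  imports "HOL-Analysis.Analysis"
begin

text \<open>
  Functions on \<open>[0,\<infinity>)\<close> are represented by functions on \<open>real\<close> of which only the
  restriction to \<open>{0..}\<close> matters.
\<close>

definition unit_sphere_area :: "nat \<Rightarrow> real" where
  \<comment> \<open>the surface measure of the unit sphere of dimension \<open>n\<close> in Euclidean space of dimension \<open>n + 1\<close>\<close>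
  "unit_sphere_area n = 2 * pi powr (real (n + 1) / 2) / Gamma (real (n + 1) / 2)"

definition slicing_const :: "nat \<Rightarrow> real" where
  "slicing_const d = 2 * unit_sphere_area (d - 2) / unit_sphere_area (d - 1)"

definition Lp_loc :: "real \<Rightarrow> (real \<Rightarrow> real) \<Rightarrow> bool" where
  "Lp_loc p f \<longleftrightarrow> set_borel_measurable lebesgue {0..} f \<and>
     (\<forall>b>0. set_integrable lebesgue {0..b} (\<lambda>x. \<bar>f x\<bar> powr p))"

definition Linf_loc :: "(real \<Rightarrow> real) \<Rightarrow> bool" where
  "Linf_loc f \<longleftrightarrow> set_borel_measurable lebesgue {0..} f \<and>
     (\<forall>b>0. bounded (f ` {0..b}))"

definition slicing_transform :: "nat \<Rightarrow> (real \<Rightarrow> real) \<Rightarrow> real \<Rightarrow> real" where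
  \<comment> \<open>Only the values at \<open>s > 0\<close> are meaningful. For \<open>d = 3\<close> the weight is \<open>1\<close> except
    at \<open>t = 1\<close>, where \<open>0 powr 0 = 0\<close>; this is a null set.\<close>
  "slicing_transform d f s =
     slicing_const d *
       (LINT t:{0..1}|lebesgue. f (t * s) * (1 - t\<^sup>2) powr ((real d - 3) / 2))"

text \<open>
  The next two notions are meant for open \<open>S\<close>: there the iterated derivatives on \<open>S\<close> depend
  only on the values of the function on \<open>S\<close>.
\<close>

definition times_differentiable_on :: "nat \<Rightarrow> (real \<Rightarrow> real) \<Rightarrow> real set \<Rightarrow> bool" where
  "times_differentiable_on n g S \<longleftrightarrow>
     (\<forall>j<n. \<forall>x\<in>S. (deriv ^^ j) g field_differentiable (at x))"

definition times_continuously_differentiable_on ::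
    "nat \<Rightarrow> (real \<Rightarrow> real) \<Rightarrow> real set \<Rightarrow> bool" where
  "times_continuously_differentiable_on n g S \<longleftrightarrow>
     times_differentiable_on n g S \<and> continuous_on S ((deriv ^^ n) g)"

definition absolutely_continuous_on :: "real set \<Rightarrow> (real \<Rightarrow> real) \<Rightarrow> bool" where
  "absolutely_continuous_on I g \<longleftrightarrow>
     (\<forall>\<epsilon>>0. \<exists>\<delta>>0. \<forall>(n::nat) (a::nat \<Rightarrow> real) b.
        (\<forall>i<n. a i \<le> b i \<and> {a i..b i} \<subseteq> I) \<longrightarrow>
        disjoint_family_on (\<lambda>i. {a i<..<b i}) {..<n} \<longrightarrow>
        (\<Sum>i<n. b i - a i) < \<delta> \<longrightarrow>
        (\<Sum>i<n. \<bar>g (b i) - g (a i)\<bar>) < \<epsilon>)"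

end

theory Submission
  imports Defs
begin

text \<open>
  Write \<open>M\<^sub>\<beta> s\<close> for the integral of \<open>f (t s) (1 - t\<^sup>2)\<^sup>\<beta>\<close> over \<open>0 \<le> t \<le> 1\<close>, so that the transform is a
  multiple of \<open>M\<^sub>\<alpha>\<close> with \<open>\<alpha> = (d - 3) / 2\<close>. By Fubini, \<open>s\<^bsup>2\<alpha>+1\<^esup> M\<^sub>\<alpha> s\<close> is an antiderivative of
  \<open>2 \<alpha> s\<^bsup>2\<alpha>\<^esup> M\<^bsub>\<alpha>-1\<^esub> s\<close> for \<open>\<alpha> > 0\<close>, which gives \<open>s M\<^sub>\<alpha>' = 2 \<alpha> M\<^bsub>\<alpha>-1\<^esub> - (2 \<alpha> + 1) M\<^sub>\<alpha>\<close> as soon as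
  \<open>M\<^bsub>\<alpha>-1\<^esub>\<close> is continuous. Iterating, the \<open>m\<close>-th derivative of \<open>M\<^sub>\<alpha>\<close> is \<open>s\<^bsup>-m\<^esup>\<close> times a linear
  combination of \<open>M\<^sub>\<alpha>, \<dots>, M\<^bsub>\<alpha>-m\<^esub>\<close> in which \<open>M\<^bsub>\<alpha>-m\<^esub>\<close> occurs with a nonzero coefficient. For
  \<open>m = \<lfloor>(d - 2) / 2\<rfloor>\<close> the last exponent \<open>\<alpha> - m\<close> is \<open>0\<close> if \<open>d\<close> is odd and \<open>-1/2\<close> if \<open>d\<close> is even.
  In the first case \<open>M\<^sub>0\<close> is a mean of \<open>f\<close>, hence absolutely continuous; in the second
  the kernel is in \<open>L\<^sup>q\<close> for all \<open>q < 2\<close>, and Young's inequality gives continuity for \<open>f\<close> in \<open>L\<^sup>p\<close>,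
  \<open>p > 2\<close>. For the indicator function of \<open>[0,1]\<close>, \<open>M\<^sub>0\<close> and \<open>M\<^bsub>-1/2\<^esub>\<close> are constant to the left of \<open>1\<close>
  and drop at least as fast as \<open>1 / s\<close> to the right of it, so they are not differentiable at \<open>1\<close>.
\<close>

subsection \<open>Means with respect to a kernel\<close>

text \<open>Borel rather than Lebesgue measurability is demanded, so that products and dilations
  such as \<open>g u * k (u / s)\<close> are again measurable; \<open>Lp_loc_borel_version\<close>
  supplies such a representative.\<close>

definition loc_integrable :: "(real \<Rightarrow> real) \<Rightarrow> bool" where
  "loc_integrable g \<longleftrightarrow> g \<in> borel_measurable borel \<and>
     (\<forall>b. integrable lborel (\<lambda>u. indicator {0..b} u * g u))"

text \<open>The integral of \<open>g (t * s) * k t\<close> over \<open>0 \<le> t \<le> 1\<close>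
  after the substitution \<open>u = t * s\<close>. Now \<open>s\<close> enters only through the
  kernel and the domain, so continuity in \<open>s\<close> can be read off from \<open>k\<close>
  even for discontinuous \<open>g\<close>.\<close>

definition kernel_mean :: "(real \<Rightarrow> real) \<Rightarrow> (real \<Rightarrow> real) \<Rightarrow> real \<Rightarrow> real" where
  "kernel_mean g k s = (\<integral>u. indicator {0..s} u * (g u * k (u / s)) \<partial>lborel) / s"

lemma integral_scaled_kernel:
  fixes h :: "real \<Rightarrow> real"
  assumes "s > 0"
  shows "(\<integral>u. indicator {0..s} u * h (u / s) \<partial>lborel) = s * (\<integral>t. indicator {0..1} t * h t \<partial>lborel)"
proof -
  have "(\<integral>u. indicator {0..s} u * h (u / s) \<partial>lborel)
      = \<bar>s\<bar> *\<^sub>R (\<integral>t. indicator {0..s} (0 + s * t) * h ((0 + s * t) / s) \<partial>lborel)"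
    using assms by (intro lborel_integral_real_affine) auto
  also have "(\<lambda>t. indicator {0..s} (0 + s * t) * h ((0 + s * t) / s)) = (\<lambda>t. indicator {0..1} t * h t)"
    using assms by (auto simp: indicator_def fun_eq_iff zero_le_mult_iff)
  finally show ?thesis using assms by simp
qed

lemma integrable_scaled_kernel:
  fixes h :: "real \<Rightarrow> real"
  assumes "s > 0" "integrable lborel (\<lambda>t. indicator {0..1} t * h t)"
  shows "integrable lborel (\<lambda>u. indicator {0..s} u * h (u / s))"
proof -
  have "integrable lborel (\<lambda>u. indicator {0..1} (0 + (1/s) * u) * h (0 + (1/s) * u))"
    using assms by (intro lborel_integrable_real_affine[where f="\<lambda>t. indicator {0..1} t * h t"]) auto
  also have "(\<lambda>u. indicator {0..1} (0 + (1/s) * u) * h (0 + (1/s) * u)) = (\<lambda>u. indicator {0..s} u * h (u / s))"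
    using assms by (auto simp: indicator_def fun_eq_iff zero_le_divide_iff)
  finally show ?thesis .
qed

lemma integrable_kernel_mean_bounded:
  assumes g: "loc_integrable g" and [measurable]: "k \<in> borel_measurable borel"
    and B: "\<And>t. t \<in> {0..1} \<Longrightarrow> \<bar>k t\<bar> \<le> B" and s: "s > 0"
  shows "integrable lborel (\<lambda>u. indicator {0..s} u * (g u * k (u / s)))"
proof -
  have [measurable]: "g \<in> borel_measurable borel" using g by (simp add: loc_integrable_def)
  have i: "integrable lborel (\<lambda>u. B * (indicator {0..s} u * g u))"
    using g by (auto simp: loc_integrable_def)
  show ?thesis
  proof (rule Bochner_Integration.integrable_bound[OF i])
    show "AE u in lborel. norm (indicator {0..s} u * (g u * k (u / s))) \<le> norm (B * (indicator {0..s} u * g u))"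
    proof (rule AE_I2)
      fix u
      show "norm (indicator {0..s} u * (g u * k (u / s))) \<le> norm (B * (indicator {0..s} u * g u))"
      proof (cases "u \<in> {0..s}")
        case True
        have "\<bar>k (u/s)\<bar> \<le> \<bar>B\<bar>" using B[of "u/s"] True s by (auto simp: divide_le_eq)
        then have "\<bar>g u\<bar> * \<bar>k (u/s)\<bar> \<le> \<bar>g u\<bar> * \<bar>B\<bar>" by (intro mult_left_mono) auto
        then show ?thesis using True by (simp add: abs_mult mult.commute)
      qed auto
    qed
  qed simp
qed

text \<open>Dominated convergence along sequences, with a multiple of \<open>\<bar>g\<bar>\<close>
  on a bounded interval as majorant.\<close>

lemma continuous_on_kernel_mean_bounded:
  assumes g: "loc_integrable g" and [measurable]: "k \<in> borel_measurable borel"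
    and B: "\<And>t. t \<in> {0..1} \<Longrightarrow> \<bar>k t\<bar> \<le> B"
    and k: "\<And>t. t \<in> {0<..<1} \<Longrightarrow> isCont k t"
  shows "continuous_on {0<..} (kernel_mean g k)"
proof -
  have [measurable]: "g \<in> borel_measurable borel" using g by (simp add: loc_integrable_def)
  have "continuous_on {0<..} (\<lambda>s. \<integral>u. indicator {0..s} u * (g u * k (u / s)) \<partial>lborel)"
  proof (rule continuous_on_sequentiallyI)
    fix X :: "nat \<Rightarrow> real" and s0
    assume X: "\<forall>n. X n \<in> {0<..}" and s0: "s0 \<in> {0<..}" and lim: "X \<longlonglongrightarrow> s0"
    obtain b where b: "\<And>n. X n \<le> b"
      using lim convergent_imp_Bseq[of X] unfolding Bseq_def convergent_def
      by (metis abs_le_D1 real_norm_def)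
    show "(\<lambda>n. \<integral>u. indicator {0..X n} u * (g u * k (u / X n)) \<partial>lborel) \<longlonglongrightarrow>
          (\<integral>u. indicator {0..s0} u * (g u * k (u / s0)) \<partial>lborel)"
    proof (rule integral_dominated_convergence)
      show "integrable lborel (\<lambda>u. \<bar>B\<bar> * \<bar>indicator {0..b} u * g u\<bar>)"
        using g by (auto simp: loc_integrable_def)
      \<comment> \<open>Convergence may fail at \<open>u = s0\<close>, where the indicator can jump
        and \<open>k\<close> is evaluated near the endpoint 1. Off the null set of 0 and
        \<open>s0\<close>, the quotient \<open>u / s0\<close> lies in the open unit interval or
        outside the closed one.\<close>
      show "AE u in lborel. (\<lambda>n. indicator {0..X n} u * (g u * k (u / X n))) \<longlonglongrightarrow>
              indicator {0..s0} u * (g u * k (u / s0))"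
        using AE_lborel_singleton[of 0] AE_lborel_singleton[of s0]
      proof eventually_elim
        case (elim u)
        consider "u < 0" | "0 < u" "u < s0" | "u > s0" using elim by linarith
        then show ?case
        proof cases
          case 2
          have "eventually (\<lambda>n. X n > u) sequentially"
            using order_tendstoD(1)[OF lim 2(2)] .
          then have e: "eventually (\<lambda>n. indicator {0..X n} u * (g u * k (u / X n)) = g u * k (u / X n)) sequentially"
            by eventually_elim (use 2 in auto)
          have "(\<lambda>n. k (u / X n)) \<longlonglongrightarrow> k (u / s0)"
          proof (rule isCont_tendsto_compose[where g=k])
            show "isCont k (u / s0)" using 2 by (intro k) auto
            show "(\<lambda>n. u / X n) \<longlonglongrightarrow> u / s0" using s0 by (intro tendsto_intros lim) auto
          qed
          then have "(\<lambda>n. g u * k (u / X n)) \<longlonglongrightarrow> g u * k (u / s0)"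
            by (intro tendsto_intros)
          then show ?thesis using 2 by (subst tendsto_cong[OF e]) simp
        next
          case 3
          have "eventually (\<lambda>n. X n < u) sequentially"
            using order_tendstoD(2)[OF lim 3] .
          then have e: "eventually (\<lambda>n. indicator {0..X n} u * (g u * k (u / X n)) = 0) sequentially"
            by eventually_elim auto
          then show ?thesis using 3 by (subst tendsto_cong[OF e]) simp
        qed auto
      qed
      show "AE u in lborel. norm (indicator {0..X n} u * (g u * k (u / X n))) \<le> \<bar>B\<bar> * \<bar>indicator {0..b} u * g u\<bar>" for n
      proof (rule AE_I2)
        fix u
        show "norm (indicator {0..X n} u * (g u * k (u / X n))) \<le> \<bar>B\<bar> * \<bar>indicator {0..b} u * g u\<bar>"
        proof (cases "u \<in> {0..X n}")
          case True
          have "\<bar>k (u/X n)\<bar> \<le> \<bar>B\<bar>" using B[of "u/X n"] True X by (auto simp: divide_le_eq)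
          then have "\<bar>g u\<bar> * \<bar>k (u/X n)\<bar> \<le> \<bar>g u\<bar> * \<bar>B\<bar>" by (intro mult_left_mono) auto
          then show ?thesis using True b[of n] by (simp add: abs_mult mult.commute)
        qed auto
      qed
    qed auto
  qed
  then show ?thesis unfolding kernel_mean_def by (intro continuous_intros) auto
qed

text \<open>The kernels \<open>min k n\<close> are bounded, and Young's inequality makes the means with respect to
  them converge uniformly on compact subintervals.\<close>

lemma continuous_on_kernel_mean_Lp:
  assumes [measurable]: "g \<in> borel_measurable borel" "k \<in> borel_measurable borel"
    and pq: "p > 1" "q > 1" "1/p + 1/q = 1"
    and gp: "\<And>b. integrable lborel (\<lambda>u. indicator {0..b} u * \<bar>g u\<bar> powr p)"
    and kq: "integrable lborel (\<lambda>t. indicator {0..1} t * k t powr q)"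
    and k0: "\<And>t. k t \<ge> 0"
    and k: "\<And>t. t \<in> {0<..<1} \<Longrightarrow> isCont k t"
    and g: "loc_integrable g"
  shows "continuous_on {0<..} (kernel_mean g k)"
proof -
  \<comment> \<open>\<open>r n\<close> is the part of \<open>k\<close> above height
    \<open>n\<close>; it is dominated by \<open>k\<close>, so the integrals of its
    \<open>q\<close>-th powers tend to 0.\<close>
  define r where "r n t = k t - min (k t) (real n)" for n t
  have rm[measurable]: "r n \<in> borel_measurable borel" for n
    unfolding r_def by measurable
  have r0: "r n t \<ge> 0" "r n t \<le> k t" for n t using k0[of t] by (auto simp: r_def)
  have rint: "integrable lborel (\<lambda>t. indicator {0..1} t * r n t powr q)" for n
    by (rule Bochner_Integration.integrable_bound[OF kq])
       (use r0 k0 pq in \<open>auto simp: indicator_def intro!: powr_mono2\<close>)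
  have rlim: "(\<lambda>n. \<integral>t. indicator {0..1} t * r n t powr q \<partial>lborel) \<longlonglongrightarrow> (\<integral>t. 0 \<partial>(lborel::real measure))"
  proof (rule integral_dominated_convergence[OF _ _ kq])
    show "AE t in lborel. (\<lambda>n. indicator {0..1} t * r n t powr q) \<longlonglongrightarrow> 0"
    proof (rule AE_I2)
      fix t :: real
      obtain N where N: "k t \<le> real N" using real_arch_simple by blast
      have "eventually (\<lambda>n. indicator {0..1} t * r n t powr q = 0) sequentially"
        using eventually_ge_at_top[of N]
      proof eventually_elim
        case (elim n)
        then have "k t \<le> real n" using N by linarith
        then have "r n t = 0" by (simp add: r_def)
        then show ?case using pq by simp
      qed
      then show "(\<lambda>n. indicator {0..1} t * r n t powr q) \<longlonglongrightarrow> 0" by (rule tendsto_eventually)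
    qed
  qed (use r0 k0 pq in \<open>auto simp: indicator_def intro!: powr_mono2\<close>)
  \<comment> \<open>Young's inequality for \<open>e * \<bar>x\<bar>\<close> and
    \<open>y / e\<close>. The parameter \<open>e\<close> will make the \<open>p\<close>-term small,
    which does not depend on the truncation level \<open>n\<close>; afterwards a large
    \<open>n\<close> makes the \<open>q\<close>-term small.\<close>
  have young: "\<bar>x\<bar> * y \<le> e powr p / p * \<bar>x\<bar> powr p + 1 / (q * e powr q) * y powr q" if "y \<ge> 0" "e > 0" for x y e :: real
  proof -
    have "(e * \<bar>x\<bar>) * (y / e) \<le> (e * \<bar>x\<bar>) powr p / p + (y/e) powr q / q"
      using pq that by (intro Youngs_inequality) auto
    then show ?thesis using that by (simp add: powr_mult powr_divide field_simps)
  qed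
  have int: "integrable lborel (\<lambda>u. indicator {0..s} u * (g u * h (u / s)))"
    if s: "s > 0" and [measurable]: "h \<in> borel_measurable borel"
      and h: "\<And>t. 0 \<le> h t" "integrable lborel (\<lambda>t. indicator {0..1} t * h t powr q)" for s h
  proof (rule Bochner_Integration.integrable_bound)
    show "integrable lborel (\<lambda>u. 1/p * (indicator {0..s} u * \<bar>g u\<bar> powr p) + 1/q * (indicator {0..s} u * h (u / s) powr q))"
      using gp integrable_scaled_kernel[OF s h(2)] by (intro Bochner_Integration.integrable_add integrable_mult_right)
    show "AE u in lborel. norm (indicator {0..s} u * (g u * h (u / s)))
        \<le> norm (1/p * (indicator {0..s} u * \<bar>g u\<bar> powr p) + 1/q * (indicator {0..s} u * h (u / s) powr q))"
      using young[of _ 1] h(1) pq by (intro AE_I2) (auto simp: indicator_def abs_mult abs_of_nonneg)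
  qed measurable
  \<comment> \<open>The bound is uniform in \<open>s\<close>: in the first term \<open>1 / s\<close>
    is replaced by \<open>1 / a\<close>, and in the second the factor \<open>s\<close> from
    rescaling the kernel cancels the division by \<open>s\<close>.\<close>
  have diff: "\<bar>kernel_mean g (\<lambda>t. min (k t) (real n)) s - kernel_mean g k s\<bar>
      \<le> e powr p / p * (\<integral>u. indicator {0..b} u * \<bar>g u\<bar> powr p \<partial>lborel) / a
        + 1 / (q * e powr q) * (\<integral>t. indicator {0..1} t * r n t powr q \<partial>lborel)"
    if s: "s \<in> {a..b}" and a: "a > 0" and e: "e > 0" for s a b e n
  proof -
    have s0: "s > 0" using s a by auto
    let ?J = "\<integral>u. indicator {0..s} u * (g u * r n (u / s)) \<partial>lborel"
    let ?P = "\<integral>u. indicator {0..b} u * \<bar>g u\<bar> powr p \<partial>lborel"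
    let ?R = "\<integral>t. indicator {0..1} t * r n t powr q \<partial>lborel"
    have i1: "integrable lborel (\<lambda>u. indicator {0..s} u * (g u * k (u / s)))"
      by (intro int s0 kq k0) auto
    have i2: "integrable lborel (\<lambda>u. indicator {0..s} u * (g u * r n (u / s)))"
      by (intro int s0 rint r0) auto
    have i3: "integrable lborel (\<lambda>u. indicator {0..s} u * (g u * min (k (u / s)) (real n)))"
    proof -
      have "integrable lborel (\<lambda>u. indicator {0..s} u * (g u * k (u / s)) - indicator {0..s} u * (g u * r n (u / s)))"
        using i1 i2 by (rule Bochner_Integration.integrable_diff)
      also have "(\<lambda>u. indicator {0..s} u * (g u * k (u / s)) - indicator {0..s} u * (g u * r n (u / s)))
          = (\<lambda>u. indicator {0..s} u * (g u * min (k (u / s)) (real n)))"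
        by (auto simp: fun_eq_iff r_def indicator_def algebra_simps)
      finally show ?thesis .
    qed
    have "kernel_mean g k s - kernel_mean g (\<lambda>t. min (k t) (real n)) s = ?J / s"
      unfolding kernel_mean_def diff_divide_distrib[symmetric] Bochner_Integration.integral_diff[OF i1 i3, symmetric]
      by (simp only: r_def right_diff_distrib)
    then have eq: "\<bar>kernel_mean g (\<lambda>t. min (k t) (real n)) s - kernel_mean g k s\<bar> = \<bar>?J\<bar> / s"
      using s0 by (metis abs_divide abs_minus_commute abs_of_pos)
    have "\<bar>?J\<bar> \<le> (\<integral>u. e powr p / p * (indicator {0..b} u * \<bar>g u\<bar> powr p)
          + 1 / (q * e powr q) * (indicator {0..s} u * r n (u / s) powr q) \<partial>lborel)"
    proof (rule order.trans[OF integral_abs_bound], rule integral_mono)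
      show "integrable lborel (\<lambda>u. \<bar>indicator {0..s} u * (g u * r n (u / s))\<bar>)"
        using i2 by (rule integrable_abs)
      show "integrable lborel (\<lambda>u. e powr p / p * (indicator {0..b} u * \<bar>g u\<bar> powr p)
          + 1 / (q * e powr q) * (indicator {0..s} u * r n (u / s) powr q))"
        using gp integrable_scaled_kernel[OF s0 rint]
        by (intro Bochner_Integration.integrable_add integrable_mult_right)
      fix u
      show "\<bar>indicator {0..s} u * (g u * r n (u / s))\<bar> \<le> e powr p / p * (indicator {0..b} u * \<bar>g u\<bar> powr p)
          + 1 / (q * e powr q) * (indicator {0..s} u * r n (u / s) powr q)"
      proof (cases "u \<in> {0..s}")
        case True
        then have "u \<in> {0..b}" using s by auto
        then show ?thesis
          using True young[OF r0(1) e, of "g u" n "u/s"] r0(1)[of n "u/s"] by (simp add: abs_mult)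
      next
        case False
        then show ?thesis using pq by simp
      qed
    qed
    also have "\<dots> = e powr p / p * (\<integral>u. indicator {0..b} u * \<bar>g u\<bar> powr p \<partial>lborel)
          + 1 / (q * e powr q) * (s * (\<integral>t. indicator {0..1} t * r n t powr q \<partial>lborel))"
      unfolding Bochner_Integration.integral_add[OF integrable_mult_right[OF gp]
          integrable_mult_right[OF integrable_scaled_kernel[OF s0 rint]]]
        integral_mult_right_zero integral_scaled_kernel[OF s0, of "\<lambda>t. r n t powr q"] ..
    finally have "\<bar>?J\<bar> / s \<le> (e powr p / p * ?P + 1 / (q * e powr q) * (s * ?R)) / s"
      using s0 by (intro divide_right_mono) auto
    moreover have "(e powr p / p * ?P + 1 / (q * e powr q) * (s * ?R)) / s = e powr p / p * ?P / s + 1 / (q * e powr q) * ?R"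
      using s0 by (simp add: add_divide_distrib)
    moreover have "e powr p / p * ?P / s \<le> e powr p / p * ?P / a"
      using s a pq by (intro divide_left_mono mult_nonneg_nonneg integral_nonneg) auto
    ultimately show ?thesis unfolding eq by linarith
  qed
  have "continuous_on {a..b} (kernel_mean g k)" if a: "a > 0" for a b
  proof (rule uniform_limit_theorem)
    show "\<forall>\<^sub>F n in sequentially. continuous_on {a..b} (kernel_mean g (\<lambda>t. min (k t) (real n)))"
    proof (rule always_eventually, rule allI)
      fix n
      have "continuous_on {0<..} (kernel_mean g (\<lambda>t. min (k t) (real n)))"
        by (rule continuous_on_kernel_mean_bounded[OF g, where B = "real n"])
           (use k k0 in \<open>auto intro!: continuous_intros\<close>)
      then show "continuous_on {a..b} (kernel_mean g (\<lambda>t. min (k t) (real n)))"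
        by (rule continuous_on_subset) (use a in auto)
    qed
    show "uniform_limit {a..b} (\<lambda>n. kernel_mean g (\<lambda>t. min (k t) (real n))) (kernel_mean g k) sequentially"
    proof (rule uniform_limitI)
      fix \<epsilon> :: real assume \<epsilon>: "\<epsilon> > 0"
      define A where "A = (\<integral>u. indicator {0..b} u * \<bar>g u\<bar> powr p \<partial>lborel) / (p * a)"
      have A: "A \<ge> 0" unfolding A_def using pq a by (intro divide_nonneg_pos integral_nonneg) auto
      \<comment> \<open>Chosen such that
        \<open>e powr p * A = \<epsilon> * A / (2 * (A + 1))\<close>, which is below
        \<open>\<epsilon> / 2\<close>; the summand 1 covers \<open>A = 0\<close>.\<close>
      define e where "e = (\<epsilon> / (2 * (A + 1))) powr (1/p)"
      have e: "e > 0" "e powr p = \<epsilon> / (2 * (A + 1))" using A \<epsilon> pq by (auto simp: e_def powr_powr)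
      have eA: "e powr p * A < \<epsilon> / 2" using A \<epsilon> by (simp add: e field_simps)
      have "(\<lambda>n. 1 / (q * e powr q) * (\<integral>t. indicator {0..1} t * r n t powr q \<partial>lborel)) \<longlonglongrightarrow> 1 / (q * e powr q) * 0"
        using rlim by (intro tendsto_intros) auto
      then have "\<forall>\<^sub>F n in sequentially. 1 / (q * e powr q) * (\<integral>t. indicator {0..1} t * r n t powr q \<partial>lborel) < \<epsilon> / 2"
        by (rule order_tendstoD(2)) (use \<epsilon> in auto)
      then show "\<forall>\<^sub>F n in sequentially. \<forall>s\<in>{a..b}. dist (kernel_mean g (\<lambda>t. min (k t) (real n)) s) (kernel_mean g k s) < \<epsilon>"
      proof eventually_elim
        case (elim n)
        show ?case
        proof
          fix s assume s: "s \<in> {a..b}"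
          have "e powr p / p * (\<integral>u. indicator {0..b} u * \<bar>g u\<bar> powr p \<partial>lborel) / a = e powr p * A"
            by (simp add: A_def)
          with diff[OF s a e(1), of n] elim eA
          show "dist (kernel_mean g (\<lambda>t. min (k t) (real n)) s) (kernel_mean g k s) < \<epsilon>"
            unfolding dist_real_def by linarith
        qed
      qed
    qed
  qed simp
  then have "isCont (kernel_mean g k) s" if "s > 0" for s
    using that continuous_on_interior[of "{s/2 .. s+1}" "kernel_mean g k" s] by auto
  then show ?thesis by (auto simp: continuous_on_eq_continuous_at)
qed

subsection \<open>The recursion for the derivative\<close>

definition slice_mean :: "(real \<Rightarrow> real) \<Rightarrow> real \<Rightarrow> real \<Rightarrow> real" where
  "slice_mean g \<beta> = kernel_mean g (\<lambda>t. (1 - t\<^sup>2) powr \<beta>)"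

text \<open>For \<open>\<beta> > -1\<close>, after substituting \<open>u\<^sup>2\<close> and up to a
  constant factor, this is an Abel (Riemann-Liouville) fractional integral of order
  \<open>\<beta> + 1\<close>, taken at \<open>s\<^sup>2\<close>.\<close>

definition abel_int :: "(real \<Rightarrow> real) \<Rightarrow> real \<Rightarrow> real \<Rightarrow> real" where
  "abel_int g \<beta> s = (\<integral>u. indicator {0..s} u * (g u * (s\<^sup>2 - u\<^sup>2) powr \<beta>) \<partial>lborel)"

text \<open>The factor \<open>s powr (2 * \<beta>)\<close> comes from
  \<open>s\<^sup>2 - u\<^sup>2 = s\<^sup>2 * (1 - (u / s)\<^sup>2)\<close>, the remaining factor
  \<open>s\<close> from the division by \<open>s\<close> in \<open>kernel_mean\<close>.\<close>

lemma abel_int_eq_slice_mean: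
  assumes "s > 0"
  shows "abel_int g \<beta> s = s powr (2 * \<beta> + 1) * slice_mean g \<beta> s"
proof -
  have "(s\<^sup>2 - u\<^sup>2) powr \<beta> = s powr (2 * \<beta>) * (1 - (u / s)\<^sup>2) powr \<beta>" if "u \<in> {0..s}" for u
  proof -
    have "(u / s)\<^sup>2 \<le> 1" using that assms by (intro power_le_one) auto
    moreover have "s\<^sup>2 - u\<^sup>2 = s\<^sup>2 * (1 - (u / s)\<^sup>2)" using assms by (simp add: field_simps)
    moreover have "s powr (2 * \<beta>) = (s\<^sup>2) powr \<beta>"
      using assms by (simp add: powr_powr flip: powr_numeral)
    ultimately show ?thesis by (simp add: powr_mult)
  qed
  then have "abel_int g \<beta> s
      = (\<integral>u. s powr (2 * \<beta>) * (indicator {0..s} u * (g u * (1 - (u / s)\<^sup>2) powr \<beta>)) \<partial>lborel)"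
    unfolding abel_int_def by (intro Bochner_Integration.integral_cong) (auto simp: indicator_def)
  also have "\<dots> = s powr (2 * \<beta>) * (s * slice_mean g \<beta> s)"
    using assms by (simp add: slice_mean_def kernel_mean_def)
  finally show ?thesis using assms by (simp add: powr_add)
qed

text \<open>The integrand is the derivative in \<open>v\<close> of
  \<open>(v\<^sup>2 - u\<^sup>2) powr \<alpha>\<close>, which vanishes at \<open>v = u\<close>. For
  small \<open>\<alpha>\<close> it is unbounded near \<open>v = u\<close>, so derivatives are taken
  in the open interval only, and nonnegativity turns the gauge integral into a Lebesgue
  integral.\<close>

lemma has_bochner_integral_abel_kernel:
  fixes u s :: real
  assumes \<alpha>: "\<alpha> > 0" and u: "0 \<le> u" "u \<le> s"
  shows "has_bochner_integral lborel (\<lambda>v. indicator {u..s} v * (2 * \<alpha> * v * (v\<^sup>2 - u\<^sup>2) powr (\<alpha> - 1)))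
           ((s\<^sup>2 - u\<^sup>2) powr \<alpha>)"
proof (rule has_bochner_integral_nn_integral)
  have "((\<lambda>v. 2 * \<alpha> * v * (v\<^sup>2 - u\<^sup>2) powr (\<alpha> - 1)) has_integral
          ((s\<^sup>2 - u\<^sup>2) powr \<alpha> - (u\<^sup>2 - u\<^sup>2) powr \<alpha>)) {u..s}"
  proof (rule fundamental_theorem_of_calculus_interior)
    show "continuous_on {u..s} (\<lambda>v. (v\<^sup>2 - u\<^sup>2) powr \<alpha>)"
      using u \<alpha> by (intro continuous_on_powr' continuous_intros) (auto intro: power_mono)
    fix v assume v: "v \<in> {u<..<s}"
    then have "v\<^sup>2 - u\<^sup>2 > 0" using u by (simp add: power_strict_mono)
    then have "((\<lambda>v. (v\<^sup>2 - u\<^sup>2) powr \<alpha>) has_real_derivative \<alpha> * (v\<^sup>2 - u\<^sup>2) powr (\<alpha> - 1) * (2 * v)) (at v)"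
      using DERIV_fun_powr[of "\<lambda>v. v\<^sup>2 - u\<^sup>2" "2 * v" v \<alpha>] by (auto intro!: derivative_eq_intros)
    then show "((\<lambda>v. (v\<^sup>2 - u\<^sup>2) powr \<alpha>) has_vector_derivative 2 * \<alpha> * v * (v\<^sup>2 - u\<^sup>2) powr (\<alpha> - 1)) (at v)"
      by (simp add: has_real_derivative_iff_has_vector_derivative mult_ac)
  qed (use u in auto)
  then show "(\<integral>\<^sup>+v. ennreal (indicator {u..s} v * (2 * \<alpha> * v * (v\<^sup>2 - u\<^sup>2) powr (\<alpha> - 1))) \<partial>lborel)
      = ennreal ((s\<^sup>2 - u\<^sup>2) powr \<alpha>)"
    using u \<alpha> by (subst nn_integral_has_integral_lebesgue) auto
qed (use u \<alpha> in \<open>auto simp: indicator_def\<close>)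

text \<open>Write \<open>(s\<^sup>2 - u\<^sup>2) powr \<alpha>\<close> as an integral over
  \<open>v\<close> from \<open>u\<close> to \<open>s\<close> and exchange the order of integration
  on the triangle \<open>0 \<le> u \<le> v \<le> s\<close>.\<close>

lemma abel_int_fubini:
  assumes g: "loc_integrable g" and \<alpha>: "\<alpha> > 0" and s: "s \<ge> 0"
  defines "w \<equiv> \<lambda>v. 2 * \<alpha> * v * abel_int g (\<alpha> - 1) v"
  shows "integrable lborel (\<lambda>v. indicator {0..s} v * w v)" (is ?I)
    and "abel_int g \<alpha> s = (\<integral>v. indicator {0..s} v * w v \<partial>lborel)" (is ?E)
proof -
  have [measurable]: "g \<in> borel_measurable borel" using g by (simp add: loc_integrable_def)
  define \<Phi> where "\<Phi> u v = (if 0 \<le> u \<and> u \<le> v \<and> v \<le> s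
    then g u * (2 * \<alpha> * v * (v\<^sup>2 - u\<^sup>2) powr (\<alpha> - 1)) else 0)" for u v
  have \<Phi>m[measurable]: "case_prod \<Phi> \<in> borel_measurable (lborel \<Otimes>\<^sub>M lborel)"
    unfolding \<Phi>_def by measurable
  have \<Phi>u: "\<Phi> u = (\<lambda>v. (indicator {0..s} u * g u) * (indicator {u..s} v * (2 * \<alpha> * v * (v\<^sup>2 - u\<^sup>2) powr (\<alpha> - 1))))" for u
    by (auto simp: \<Phi>_def fun_eq_iff indicator_def)
  have inner: "has_bochner_integral lborel (\<Phi> u) ((indicator {0..s} u * g u) * (s\<^sup>2 - u\<^sup>2) powr \<alpha>)" for u
  proof (cases "u \<in> {0..s}")
    case True
    then show ?thesis unfolding \<Phi>u
      by (intro has_bochner_integral_mult_right has_bochner_integral_abel_kernel \<alpha>) auto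
  next
    case False
    then show ?thesis unfolding \<Phi>u by (simp add: has_bochner_integral_zero)
  qed
  have nrm: "norm (\<Phi> u v) = \<bar>indicator {0..s} u * g u\<bar> * (indicator {u..s} v * (2 * \<alpha> * v * (v\<^sup>2 - u\<^sup>2) powr (\<alpha> - 1)))" for u v
    using \<alpha> unfolding \<Phi>u by (auto simp: abs_mult indicator_def)
  have inner_norm: "(\<integral>v. norm (\<Phi> u v) \<partial>lborel) = \<bar>indicator {0..s} u * g u\<bar> * (s\<^sup>2 - u\<^sup>2) powr \<alpha>" for u
  proof (cases "u \<in> {0..s}")
    case True
    then have "has_bochner_integral lborel (\<lambda>v. norm (\<Phi> u v)) (\<bar>indicator {0..s} u * g u\<bar> * (s\<^sup>2 - u\<^sup>2) powr \<alpha>)"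
      unfolding nrm by (intro has_bochner_integral_mult_right has_bochner_integral_abel_kernel \<alpha>) auto
    then show ?thesis by (rule has_bochner_integral_integral_eq)
  next
    case False
    then show ?thesis unfolding nrm by simp
  qed
  \<comment> \<open>Absolute integrability: integrating \<open>\<bar>\<Phi> u v\<bar>\<close> over
    \<open>v\<close> leaves \<open>\<bar>g u\<bar> * (s\<^sup>2 - u\<^sup>2) powr \<alpha>\<close>,
    which is at most \<open>(s\<^sup>2) powr \<alpha> * \<bar>g u\<bar>\<close> for \<open>u\<close>
    in \<open>{0..s}\<close>.\<close>
  have int: "integrable (lborel \<Otimes>\<^sub>M lborel) (case_prod \<Phi>)"
  proof (rule lborel_pair.Fubini_integrable)
    show "integrable lborel (\<lambda>u. \<integral>v. norm (case_prod \<Phi> (u, v)) \<partial>lborel)"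
      unfolding case_prod_conv inner_norm
    proof (rule Bochner_Integration.integrable_bound)
      show "integrable lborel (\<lambda>u. (s\<^sup>2) powr \<alpha> * (indicator {0..s} u * g u))"
        using g by (auto simp: loc_integrable_def)
      show "AE u in lborel. norm (\<bar>indicator {0..s} u * g u\<bar> * (s\<^sup>2 - u\<^sup>2) powr \<alpha>)
          \<le> norm ((s\<^sup>2) powr \<alpha> * (indicator {0..s} u * g u))"
      proof (rule AE_I2)
        fix u
        have "(s\<^sup>2 - u\<^sup>2) powr \<alpha> \<le> (s\<^sup>2) powr \<alpha>" if "u \<in> {0..s}"
          using that \<alpha> by (intro powr_mono2) (auto intro: power_mono)
        then have "\<bar>g u\<bar> * (s\<^sup>2 - u\<^sup>2) powr \<alpha> \<le> \<bar>g u\<bar> * (s\<^sup>2) powr \<alpha>" if "u \<in> {0..s}"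
          using that by (intro mult_left_mono) auto
        then show "norm (\<bar>indicator {0..s} u * g u\<bar> * (s\<^sup>2 - u\<^sup>2) powr \<alpha>)
            \<le> norm ((s\<^sup>2) powr \<alpha> * (indicator {0..s} u * g u))"
          by (auto simp: indicator_def abs_mult mult.commute)
      qed
    qed measurable
    show "AE u in lborel. integrable lborel (\<lambda>v. case_prod \<Phi> (u, v))"
      using inner by (auto simp: has_bochner_integral_iff)
  qed measurable
  have outer: "(\<integral>u. \<Phi> u v \<partial>lborel) = indicator {0..s} v * w v" for v
  proof -
    have "\<Phi> u v = (indicator {0..s} v * (2 * \<alpha> * v)) * (indicator {0..v} u * (g u * (v\<^sup>2 - u\<^sup>2) powr (\<alpha> - 1)))" for u
      by (auto simp: \<Phi>_def indicator_def)
    then show ?thesis by (simp add: w_def abel_int_def)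
  qed
  show ?I using lborel_pair.integrable_snd[OF int] by (simp add: outer)
  have "(\<integral>u. (\<integral>v. \<Phi> u v \<partial>lborel) \<partial>lborel) = abel_int g \<alpha> s"
    using inner by (simp add: has_bochner_integral_iff abel_int_def mult.assoc)
  then show ?E using lborel_pair.Fubini_integral[OF int] by (simp add: outer)
qed

text \<open>The fundamental theorem at a single point: \<open>abel_int g \<alpha>\<close> is the
  indefinite integral of \<open>w\<close> from 0. Integrability of \<open>w\<close> up to 0 comes
  from Fubini, and \<open>cont\<close> gives its continuity at \<open>s\<close>.\<close>

lemma has_real_derivative_abel_int:
  assumes g: "loc_integrable g" and \<alpha>: "\<alpha> > 0" and s: "s > 0"
    and cont: "continuous_on {0<..} (slice_mean g (\<alpha> - 1))"
  shows "(abel_int g \<alpha> has_real_derivative 2 * \<alpha> * s * abel_int g (\<alpha> - 1) s) (at s)"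
proof -
  define w where "w v = 2 * \<alpha> * v * abel_int g (\<alpha> - 1) v" for v
  have "continuous_on {0<..} (\<lambda>v. v powr (2 * (\<alpha> - 1) + 1) * slice_mean g (\<alpha> - 1) v)"
    using cont by (intro continuous_intros) auto
  then have "continuous_on {0<..} (abel_int g (\<alpha> - 1))"
    by (rule continuous_on_eq) (simp add: abel_int_eq_slice_mean)
  then have "continuous_on {0<..} w" unfolding w_def by (intro continuous_intros)
  then have cw: "isCont w s" using s by (simp add: continuous_on_eq_continuous_at)
  have si: "set_integrable lborel {0..x} w" if "x \<ge> 0" for x
    using abel_int_fubini(1)[OF g \<alpha> that] by (simp add: set_integrable_def w_def)
  have eq: "abel_int g \<alpha> x = integral {0..x} w" if "x \<ge> 0" for x
    using abel_int_fubini(2)[OF g \<alpha> that] set_borel_integral_eq_integral(2)[OF si[OF that]]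
    by (simp add: set_lebesgue_integral_def w_def)
  have "((\<lambda>x. integral {0..x} w) has_vector_derivative w s) (at s within ({0..s+1} - {}))"
  proof (rule integral_has_vector_derivative_continuous_at)
    show "w integrable_on {0..s+1}" using s by (intro set_borel_integral_eq_integral(1) si) auto
    show "continuous (at s within {0..s+1} - {}) w" using cw by (rule continuous_at_imp_continuous_at_within)
  qed (use s in auto)
  then have "((\<lambda>x. integral {0..x} w) has_real_derivative w s) (at s)"
    using s at_within_Icc_at[of 0 s "s+1"] by (simp add: has_real_derivative_iff_has_vector_derivative)
  then have "(abel_int g \<alpha> has_real_derivative w s) (at s)"
    by (rule has_field_derivative_transform_within_open[where S = "{0<..}"]) (use s eq in auto)
  then show ?thesis by (simp add: w_def)
qed

text \<open>The product rule for \<open>x powr (- 2 * \<alpha> - 1) * abel_int g \<alpha> x\<close>.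
  After returning to slice means, the powers of \<open>s\<close> in each term combine to
  \<open>1 / s\<close>; these are the facts \<open>1\<close> and \<open>2\<close>.\<close>

lemma has_real_derivative_slice_mean:
  assumes g: "loc_integrable g" and \<alpha>: "\<alpha> > 0" and s: "s > 0"
    and cont: "continuous_on {0<..} (slice_mean g (\<alpha> - 1))"
  shows "(slice_mean g \<alpha> has_real_derivative (2 * \<alpha> * slice_mean g (\<alpha> - 1) s - (2 * \<alpha> + 1) * slice_mean g \<alpha> s) / s) (at s)"
proof -
  have eq: "slice_mean g \<alpha> x = x powr (- 2 * \<alpha> - 1) * abel_int g \<alpha> x" if "x > 0" for x
    using that by (simp add: abel_int_eq_slice_mean mult.assoc[symmetric] powr_add[symmetric])
  have "((\<lambda>x. x powr (- 2 * \<alpha> - 1) * abel_int g \<alpha> x) has_real_derivative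
      ((- 2 * \<alpha> - 1) * s powr (- 2 * \<alpha> - 1 - 1)) * abel_int g \<alpha> s
      + (2 * \<alpha> * s * abel_int g (\<alpha> - 1) s) * s powr (- 2 * \<alpha> - 1)) (at s)"
    by (intro DERIV_mult has_real_derivative_powr has_real_derivative_abel_int assms)
  then have D: "(slice_mean g \<alpha> has_real_derivative
      ((- 2 * \<alpha> - 1) * s powr (- 2 * \<alpha> - 1 - 1)) * abel_int g \<alpha> s
      + (2 * \<alpha> * s * abel_int g (\<alpha> - 1) s) * s powr (- 2 * \<alpha> - 1)) (at s)"
    by (rule has_field_derivative_transform_within_open[where S = "{0<..}"]) (use s eq in auto)
  have 1: "s powr (- 2 * \<alpha> - 1 - 1) * s powr (2 * \<alpha> + 1) = 1 / s"
    using s by (simp add: powr_add[symmetric] powr_minus_divide)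
  have 2: "s * s powr (2 * (\<alpha> - 1) + 1) * s powr (- 2 * \<alpha> - 1) = 1 / s"
  proof -
    have "s * s powr (2 * (\<alpha> - 1) + 1) * s powr (- 2 * \<alpha> - 1)
        = s powr 1 * s powr (2 * (\<alpha> - 1) + 1) * s powr (- 2 * \<alpha> - 1)" using s by simp
    also have "\<dots> = s powr (- 1)" by (simp only: powr_add[symmetric]) simp
    finally show ?thesis using s by (simp add: powr_minus_divide)
  qed
  have "((- 2 * \<alpha> - 1) * s powr (- 2 * \<alpha> - 1 - 1)) * abel_int g \<alpha> s
      + (2 * \<alpha> * s * abel_int g (\<alpha> - 1) s) * s powr (- 2 * \<alpha> - 1)
    = (- 2 * \<alpha> - 1) * slice_mean g \<alpha> s * (s powr (- 2 * \<alpha> - 1 - 1) * s powr (2 * \<alpha> + 1))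
      + 2 * \<alpha> * slice_mean g (\<alpha> - 1) s * (s * s powr (2 * (\<alpha> - 1) + 1) * s powr (- 2 * \<alpha> - 1))"
    unfolding abel_int_eq_slice_mean[OF s] by (simp only: mult_ac)
  also have "\<dots> = (2 * \<alpha> * slice_mean g (\<alpha> - 1) s - (2 * \<alpha> + 1) * slice_mean g \<alpha> s) / s"
    unfolding 1 2 by (simp add: diff_divide_distrib add_divide_distrib algebra_simps)
  finally show ?thesis using D by simp
qed

section \<open>Continuity of the means for the exponents that occur\<close>

lemma one_minus_square_kernel:
  fixes \<beta> :: real
  shows "(\<lambda>t. (1 - t\<^sup>2) powr \<beta>) \<in> borel_measurable borel"
    and "t \<in> {0<..<1} \<Longrightarrow> isCont (\<lambda>t. (1 - t\<^sup>2) powr \<beta>) t"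
proof -
  show "(\<lambda>t. (1 - t\<^sup>2) powr \<beta>) \<in> borel_measurable borel" by measurable
  assume "t \<in> {0<..<1}"
  then have "t\<^sup>2 < 1" by (simp add: abs_square_less_1)
  then show "isCont (\<lambda>t. (1 - t\<^sup>2) powr \<beta>) t" by (intro continuous_intros) auto
qed

text \<open>For \<open>\<beta> \<ge> 0\<close> the kernel is bounded by 1 on
  \<open>{0..1}\<close>.\<close>

lemma continuous_on_slice_mean_nonneg:
  assumes "loc_integrable g" "\<beta> \<ge> 0"
  shows "continuous_on {0<..} (slice_mean g \<beta>)"
  unfolding slice_mean_def
proof (rule continuous_on_kernel_mean_bounded[where B = 1])
  fix t :: real assume "t \<in> {0..1}"
  then have "t\<^sup>2 \<le> 1" by (auto intro: power_le_one)
  then show "\<bar>(1 - t\<^sup>2) powr \<beta>\<bar> \<le> 1" using assms by (simp add: powr_le1)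
qed (use assms one_minus_square_kernel in auto)

text \<open>Since \<open>1 - t \<le> 1 - t\<^sup>2\<close> on the unit interval and
  \<open>\<gamma> \<le> 0\<close>, the kernel is dominated by \<open>(1 - t) powr \<gamma>\<close>,
  the integrand of a Beta integral with parameters 1 and \<open>\<gamma> + 1\<close>.\<close>

lemma integrable_one_minus_square_powr:
  fixes \<gamma> :: real
  assumes "-1 < \<gamma>" "\<gamma> \<le> 0"
  shows "integrable lborel (\<lambda>t. indicator {0..1} t * (1 - t\<^sup>2) powr \<gamma>)"
proof (rule Bochner_Integration.integrable_bound)
  show "integrable lborel (\<lambda>t. indicator {0..1} t *\<^sub>R (t powr (1 - 1) * (1 - t) powr (\<gamma> + 1 - 1)))"
    using integrable_Beta[of 1 "\<gamma> + 1"] assms by (simp add: set_integrable_def)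
  \<comment> \<open>At \<open>t = 0\<close> the majorant contains \<open>0 powr 0 = 0\<close> and
    the inequality is false, so this point has to be removed; \<open>t = 1\<close> is removed to
    keep the bases positive.\<close>
  show "AE t in lborel. norm (indicator {0..1} t * (1 - t\<^sup>2) powr \<gamma>)
      \<le> norm (indicator {0..1} t *\<^sub>R (t powr (1 - 1) * (1 - t) powr (\<gamma> + 1 - 1)))"
    using AE_lborel_singleton[of 0] AE_lborel_singleton[of 1]
  proof eventually_elim
    case (elim t)
    have "(1 - t\<^sup>2) powr \<gamma> \<le> (1 - t) powr \<gamma>" if "t \<in> {0..1}"
    proof (rule powr_mono2')
      have "t\<^sup>2 \<le> t" using that by (simp add: power2_eq_square mult_left_le_one_le)
      then show "1 - t \<le> 1 - t\<^sup>2" by simp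
    qed (use that elim assms in auto)
    then show ?case using elim by (auto simp: indicator_def)
  qed
qed measurable

text \<open>The exponent conjugate to \<open>p > 2\<close> is \<open>q = p / (p - 1) < 2\<close>,
  hence \<open>- q / 2 > -1\<close> and the kernel has integrable \<open>q\<close>-th
  powers.\<close>

lemma continuous_on_slice_mean_neg_half:
  assumes g: "loc_integrable g" and p: "p > 2"
    and gp: "\<And>b. integrable lborel (\<lambda>u. indicator {0..b} u * \<bar>g u\<bar> powr p)"
  shows "continuous_on {0<..} (slice_mean g (- 1 / 2))"
  unfolding slice_mean_def
proof (rule continuous_on_kernel_mean_Lp[where p = p and q = "p / (p - 1)"])
  have q: "- 1 < - 1 / 2 * (p / (p - 1))" "- 1 / 2 * (p / (p - 1)) \<le> 0" using p by (auto simp: field_simps)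
  show "integrable lborel (\<lambda>t. indicator {0..1} t * ((1 - t\<^sup>2) powr (- 1 / 2)) powr (p / (p - 1)))"
    using integrable_one_minus_square_powr[OF q] by (simp only: powr_powr)
  show "1 / p + 1 / (p / (p - 1)) = 1" using p by (simp add: field_simps)
qed (use assms one_minus_square_kernel in \<open>auto simp: loc_integrable_def field_simps\<close>)

section \<open>Iterated derivatives\<close>

lemma has_real_derivative_slice_mean_over_power:
  assumes "loc_integrable g" "\<alpha> > 0" "s > 0" "continuous_on {0<..} (slice_mean g (\<alpha> - 1))"
  shows "((\<lambda>s. slice_mean g \<alpha> s / s ^ n) has_real_derivative
    (2 * \<alpha> * slice_mean g (\<alpha> - 1) s - (2 * \<alpha> + 1 + real n) * slice_mean g \<alpha> s) / s ^ Suc n) (at s)"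
proof -
  have "((\<lambda>s. slice_mean g \<alpha> s / s ^ n) has_real_derivative
      ((2 * \<alpha> * slice_mean g (\<alpha> - 1) s - (2 * \<alpha> + 1) * slice_mean g \<alpha> s) / s * s ^ n
        - slice_mean g \<alpha> s * (real n * s ^ (n - 1))) / (s ^ n * s ^ n)) (at s)"
    using assms by (intro DERIV_divide has_real_derivative_slice_mean) (auto intro!: derivative_eq_intros)
  moreover have "real n * s ^ (n - 1) = real n * s ^ n / s"
    using assms by (cases n) auto
  moreover have "((A - (2 * \<alpha> + 1) * J) / s * s ^ n - J * (real n * s ^ n / s)) / (s ^ n * s ^ n)
      = (A - (2 * \<alpha> + 1 + real n) * J) / s ^ Suc n" for A J
    using assms by (simp add: divide_simps) (simp add: algebra_simps)
  ultimately show ?thesis by simp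
qed

text \<open>Differentiating a mean over \<open>s ^ n\<close> gives the means of the same and of the
  next lower exponent over \<open>s ^ Suc n\<close>, so the shape of the sum is preserved. Only the
  coefficient of the lowest exponent is made explicit, because optimality needs it to be
  nonzero.\<close>

lemma iterated_deriv_slice_mean:
  fixes \<alpha> :: real
  assumes g: "loc_integrable g" and F: "\<And>s. s > 0 \<Longrightarrow> F s = C * slice_mean g \<alpha> s"
    and pos: "\<And>i. i < n \<Longrightarrow> real i < \<alpha>"
    and cont: "\<And>i. i < n \<Longrightarrow> continuous_on {0<..} (slice_mean g (\<alpha> - real (Suc i)))"
  shows "\<exists>c. c n = C * (\<Prod>i<n. 2 * (\<alpha> - real i)) \<and>
    (\<forall>s>0. (deriv ^^ n) F s = (\<Sum>i\<le>n. c i * (slice_mean g (\<alpha> - real i) s / s ^ n)))"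
  using pos cont
proof (induction n)
  case 0
  show ?case by (rule exI[of _ "\<lambda>_. C"]) (use F in auto)
next
  case (Suc n)
  have "\<exists>c. c n = C * (\<Prod>i<n. 2 * (\<alpha> - real i)) \<and>
    (\<forall>s>0. (deriv ^^ n) F s = (\<Sum>i\<le>n. c i * (slice_mean g (\<alpha> - real i) s / s ^ n)))"
    using Suc.prems by (intro Suc.IH) auto
  then obtain c where cn: "c n = C * (\<Prod>i<n. 2 * (\<alpha> - real i))"
    and c: "\<And>s. s > 0 \<Longrightarrow> (deriv ^^ n) F s = (\<Sum>i\<le>n. c i * (slice_mean g (\<alpha> - real i) s / s ^ n))"
    by blast
  \<comment> \<open>\<open>a i\<close> collects what stays at the exponent
    \<open>\<alpha> - i\<close>, \<open>b i\<close> what arrives there from the exponent above it.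
    The defaults \<open>a (Suc n) = 0\<close> and \<open>b 0 = 0\<close> let both sums run over
    \<open>i \<le> Suc n\<close>.\<close>
  define a where "a i = (if i \<le> n then - c i * (2 * (\<alpha> - real i) + 1 + real n) else 0)" for i
  define b where "b i = (case i of 0 \<Rightarrow> 0 | Suc j \<Rightarrow> c j * (2 * (\<alpha> - real j)))" for i
  define J where "J i s = slice_mean g (\<alpha> - real i) s / s ^ Suc n" for i s
  have "(deriv ^^ Suc n) F s = (\<Sum>i\<le>Suc n. (a i + b i) * J i s)" if s: "s > 0" for s
  proof -
    have "((\<lambda>s. \<Sum>i\<le>n. c i * (slice_mean g (\<alpha> - real i) s / s ^ n)) has_real_derivative
        (\<Sum>i\<le>n. c i * ((2 * (\<alpha> - real i) * slice_mean g (\<alpha> - real i - 1) s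
          - (2 * (\<alpha> - real i) + 1 + real n) * slice_mean g (\<alpha> - real i) s) / s ^ Suc n))) (at s)"
      using Suc.prems s
      by (intro DERIV_sum DERIV_cmult has_real_derivative_slice_mean_over_power g) (auto simp: less_Suc_eq_le algebra_simps)
    also have "(\<Sum>i\<le>n. c i * ((2 * (\<alpha> - real i) * slice_mean g (\<alpha> - real i - 1) s
          - (2 * (\<alpha> - real i) + 1 + real n) * slice_mean g (\<alpha> - real i) s) / s ^ Suc n))
        = (\<Sum>i\<le>n. a i * J i s) + (\<Sum>i\<le>n. b (Suc i) * J (Suc i) s)"
      unfolding sum.distrib[symmetric]
    proof (intro sum.cong refl)
      fix i assume i: "i \<in> {..n}"
      have "c i * ((x * A - y * B) / D) = - c i * y * (B / D) + c i * x * (A / D)" for x y A B D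
        by (simp add: diff_divide_distrib algebra_simps)
      then show "c i * ((2 * (\<alpha> - real i) * slice_mean g (\<alpha> - real i - 1) s
          - (2 * (\<alpha> - real i) + 1 + real n) * slice_mean g (\<alpha> - real i) s) / s ^ Suc n)
        = a i * J i s + b (Suc i) * J (Suc i) s"
        using i by (simp add: a_def b_def J_def diff_diff_eq add.commute del: power_Suc)
    qed
    also have "\<dots> = (\<Sum>i\<le>Suc n. a i * J i s) + (\<Sum>i\<le>Suc n. b i * J i s)"
      unfolding sum.atMost_Suc_shift[of "\<lambda>i. b i * J i s"] sum.atMost_Suc[of "\<lambda>i. a i * J i s"]
      by (simp add: a_def b_def)
    also have "\<dots> = (\<Sum>i\<le>Suc n. (a i + b i) * J i s)"
      by (simp only: sum.distrib[symmetric] distrib_right)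
    finally have "((deriv ^^ n) F has_real_derivative (\<Sum>i\<le>Suc n. (a i + b i) * J i s)) (at s)"
      by (rule has_field_derivative_transform_within_open[where S = "{0<..}"]) (use s c in auto)
    then show ?thesis by (simp add: DERIV_imp_deriv)
  qed
  moreover have "a (Suc n) + b (Suc n) = C * (\<Prod>i<Suc n. 2 * (\<alpha> - real i))"
    by (simp add: a_def b_def cn)
  ultimately show ?case unfolding J_def by (intro exI[of _ "\<lambda>i. a i + b i"]) auto
qed

text \<open>For \<open>j < n\<close> every mean in the formula for the \<open>j\<close>-th
  derivative is differentiable; for \<open>j = n\<close> the last one, of exponent
  \<open>\<alpha> - n\<close>, is only known to be continuous.\<close>

lemma times_continuously_differentiable_on_slice_mean:
  fixes \<alpha> :: real
  assumes g: "loc_integrable g" and F: "\<And>s. s > 0 \<Longrightarrow> F s = C * slice_mean g \<alpha> s"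
    and pos: "\<And>i. i < n \<Longrightarrow> real i < \<alpha>"
    and cont: "\<And>i. i \<le> n \<Longrightarrow> continuous_on {0<..} (slice_mean g (\<alpha> - real i))"
  shows "times_continuously_differentiable_on n F {0<..}"
  unfolding times_continuously_differentiable_on_def times_differentiable_on_def
proof (intro conjI allI impI ballI)
  fix j x assume j: "j < n" and x: "x \<in> {0::real<..}"
  have "\<exists>c. c j = C * (\<Prod>i<j. 2 * (\<alpha> - real i)) \<and>
    (\<forall>s>0. (deriv ^^ j) F s = (\<Sum>i\<le>j. c i * (slice_mean g (\<alpha> - real i) s / s ^ j)))"
    using j by (intro iterated_deriv_slice_mean g F pos cont) auto
  then obtain c where c: "\<And>s. s > 0 \<Longrightarrow> (deriv ^^ j) F s = (\<Sum>i\<le>j. c i * (slice_mean g (\<alpha> - real i) s / s ^ j))"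
    by blast
  have "((\<lambda>s. \<Sum>i\<le>j. c i * (slice_mean g (\<alpha> - real i) s / s ^ j)) has_real_derivative
        (\<Sum>i\<le>j. c i * ((2 * (\<alpha> - real i) * slice_mean g (\<alpha> - real i - 1) x
          - (2 * (\<alpha> - real i) + 1 + real j) * slice_mean g (\<alpha> - real i) x) / x ^ Suc j))) (at x)"
    using pos cont[of "Suc _"] j x
    by (intro DERIV_sum DERIV_cmult has_real_derivative_slice_mean_over_power g) (auto simp: diff_diff_eq add.commute)
  then have "((deriv ^^ j) F has_real_derivative
        (\<Sum>i\<le>j. c i * ((2 * (\<alpha> - real i) * slice_mean g (\<alpha> - real i - 1) x
          - (2 * (\<alpha> - real i) + 1 + real j) * slice_mean g (\<alpha> - real i) x) / x ^ Suc j))) (at x)"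
    by (rule has_field_derivative_transform_within_open[where S = "{0<..}"]) (use x c in auto)
  then show "(deriv ^^ j) F field_differentiable (at x)"
    by (auto simp: field_differentiable_def)
next
  have "\<exists>c. c n = C * (\<Prod>i<n. 2 * (\<alpha> - real i)) \<and>
    (\<forall>s>0. (deriv ^^ n) F s = (\<Sum>i\<le>n. c i * (slice_mean g (\<alpha> - real i) s / s ^ n)))"
    by (intro iterated_deriv_slice_mean g F pos cont) auto
  then obtain c where c: "\<And>s. s > 0 \<Longrightarrow> (deriv ^^ n) F s = (\<Sum>i\<le>n. c i * (slice_mean g (\<alpha> - real i) s / s ^ n))"
    by blast
  have "continuous_on {0<..} (\<lambda>s. \<Sum>i\<le>n. c i * (slice_mean g (\<alpha> - real i) s / s ^ n))"
    by (intro continuous_intros cont) auto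
  then show "continuous_on {0<..} ((deriv ^^ n) F)"
    by (rule continuous_on_eq) (use c in auto)
qed

subsection \<open>Absolute continuity\<close>

text \<open>The weight splits into a part bounded by \<open>N\<close> and a remainder
  \<open>V N\<close> of integral below \<open>\<epsilon> / 2\<close>. On intervals of total length
  below \<open>\<delta>\<close> the bounded part contributes at most
  \<open>N * \<delta> < \<epsilon> / 2\<close>.\<close>

lemma absolutely_continuous_on_dominated:
  fixes h w :: "real \<Rightarrow> real"
  assumes w: "integrable lborel (\<lambda>u. indicator {a..b} u * w u)" and w0: "\<And>u. w u \<ge> 0"
    and dom: "\<And>x y. a \<le> x \<Longrightarrow> x \<le> y \<Longrightarrow> y \<le> b \<Longrightarrow>
      \<bar>h y - h x\<bar> \<le> (\<integral>u. indicator {x..y} u * w u \<partial>lborel)"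
  shows "absolutely_continuous_on {a..b} h"
  unfolding absolutely_continuous_on_def
proof (intro allI impI)
  fix \<epsilon> :: real assume \<epsilon>: "\<epsilon> > 0"
  define W where "W u = indicator {a..b} u * w u" for u
  have Wi: "integrable lborel W" using w by (simp add: W_def[abs_def])
  have W0: "W u \<ge> 0" for u using w0 by (simp add: W_def)
  have [measurable]: "W \<in> borel_measurable borel" using borel_measurable_integrable[OF Wi] by simp
  define V where "V n u = W u - min (W u) (real n)" for n u
  have Vm[measurable]: "V n \<in> borel_measurable borel" for n unfolding V_def by measurable
  have V0: "0 \<le> V n u" "V n u \<le> W u" for n u using W0[of u] by (auto simp: V_def)
  have Vi: "integrable lborel (V n)" for n
    by (rule Bochner_Integration.integrable_bound[OF Wi]) (use V0 W0 in auto)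
  have "(\<lambda>n. \<integral>u. V n u \<partial>lborel) \<longlonglongrightarrow> (\<integral>u. 0 \<partial>(lborel::real measure))"
  proof (rule integral_dominated_convergence[OF _ _ Wi])
    show "AE u in lborel. (\<lambda>n. V n u) \<longlonglongrightarrow> 0"
    proof (rule AE_I2)
      fix u
      obtain N where N: "W u \<le> real N" using real_arch_simple by blast
      have "eventually (\<lambda>n. V n u = 0) sequentially"
        using eventually_ge_at_top[of N]
      proof eventually_elim
        case (elim n)
        then have "W u \<le> real n" using N by linarith
        then show ?case by (simp add: V_def)
      qed
      then show "(\<lambda>n. V n u) \<longlonglongrightarrow> 0" by (rule tendsto_eventually)
    qed
  qed (use V0 W0 in auto)
  then have "\<forall>\<^sub>F n in sequentially. (\<integral>u. V n u \<partial>lborel) < \<epsilon> / 2"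
    using \<epsilon> by (intro order_tendstoD(2)) auto
  then obtain N where N: "(\<integral>u. V N u \<partial>lborel) < \<epsilon> / 2"
    by (auto simp: eventually_sequentially)
  define \<delta> where "\<delta> = \<epsilon> / (2 * (real N + 1))"
  have \<delta>: "\<delta> > 0" using \<epsilon> by (simp add: \<delta>_def)
  have key: "(\<Sum>i<n. \<bar>h (B i) - h (A i)\<bar>) < \<epsilon>"
    if sub: "\<forall>i<n. A i \<le> B i \<and> {A i..B i} \<subseteq> {a..b}"
      and disj: "disjoint_family_on (\<lambda>i. {A i<..<B i}) {..<n}"
      and small: "(\<Sum>i<n. B i - A i) < \<delta>" for n and A B :: "nat \<Rightarrow> real"
  proof -
    \<comment> \<open>Disjointness is given for the open intervals; passing to them discards two
      null points per interval.\<close>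
    let ?I = "\<lambda>i. indicator {A i<..<B i} :: real \<Rightarrow> real"
    have IV: "integrable lborel (\<lambda>u. ?I i u * V N u)" for i
      using integrable_mult_indicator[OF _ Vi, of "{A i<..<B i}" N] by simp
    have step: "\<bar>h (B i) - h (A i)\<bar> \<le> (\<integral>u. ?I i u * V N u \<partial>lborel) + real N * (B i - A i)" if i: "i < n" for i
    proof -
      have Ai: "a \<le> A i" "A i \<le> B i" "B i \<le> b" using sub i by auto
      have I1: "integrable lborel (?I i)" using Ai by (auto simp: integrable_indicator_iff)
      have "\<bar>h (B i) - h (A i)\<bar> \<le> (\<integral>u. indicator {A i..B i} u * w u \<partial>lborel)"
        using Ai by (intro dom) auto
      also have "\<dots> \<le> (\<integral>u. ?I i u * V N u + real N * ?I i u \<partial>lborel)"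
      proof (rule integral_mono_AE)
        have "(\<lambda>u. indicator {A i..B i} u * w u) = (\<lambda>u. indicator {A i..B i} u *\<^sub>R W u)"
          using Ai by (auto simp: W_def indicator_def fun_eq_iff)
        then show "integrable lborel (\<lambda>u. indicator {A i..B i} u * w u)"
          using integrable_mult_indicator[OF _ Wi, of "{A i..B i}"] by simp
        show "integrable lborel (\<lambda>u. ?I i u * V N u + real N * ?I i u)"
          by (intro Bochner_Integration.integrable_add IV integrable_mult_right I1)
        show "AE u in lborel. indicator {A i..B i} u * w u \<le> ?I i u * V N u + real N * ?I i u"
          using AE_lborel_singleton[of "A i"] AE_lborel_singleton[of "B i"]
          by eventually_elim (use Ai in \<open>auto simp: indicator_def V_def W_def\<close>)
      qed
      also have "\<dots> = (\<integral>u. ?I i u * V N u \<partial>lborel) + real N * (B i - A i)"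
        using Ai by (subst Bochner_Integration.integral_add[OF IV integrable_mult_right[OF I1]]) simp
      finally show ?thesis .
    qed
    have "(\<Sum>i<n. \<bar>h (B i) - h (A i)\<bar>) \<le> (\<Sum>i<n. (\<integral>u. ?I i u * V N u \<partial>lborel) + real N * (B i - A i))"
      by (intro sum_mono step) auto
    also have "\<dots> = (\<integral>u. (\<Sum>i<n. ?I i u * V N u) \<partial>lborel) + real N * (\<Sum>i<n. B i - A i)"
      unfolding Bochner_Integration.integral_sum[OF IV] sum.distrib sum_distrib_left ..
    finally have "(\<Sum>i<n. \<bar>h (B i) - h (A i)\<bar>)
      \<le> (\<integral>u. (\<Sum>i<n. ?I i u * V N u) \<partial>lborel) + real N * (\<Sum>i<n. B i - A i)" .
    moreover have "(\<integral>u. (\<Sum>i<n. ?I i u * V N u) \<partial>lborel) \<le> (\<integral>u. V N u \<partial>lborel)"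
    proof (rule integral_mono)
      show "integrable lborel (\<lambda>u. \<Sum>i<n. ?I i u * V N u)" by (rule Bochner_Integration.integrable_sum) (rule IV)
      \<comment> \<open>By disjointness the sum of the indicators is the indicator of the union,
        hence at most 1.\<close>
      show "(\<Sum>i<n. ?I i u * V N u) \<le> V N u" for u
        unfolding sum_distrib_right[symmetric] indicator_UN_disjoint[OF finite_lessThan disj, symmetric]
        using V0(1)[of N u] by (simp add: indicator_def)
    qed (rule Vi)
    moreover have "real N * (\<Sum>i<n. B i - A i) \<le> real N * \<delta>"
      using small by (intro mult_left_mono) auto
    moreover have "real N * \<delta> < \<epsilon> / 2" using \<epsilon> by (simp add: \<delta>_def field_simps)
    ultimately show ?thesis using N by linarith
  qed
  show "\<exists>\<delta>>0. \<forall>(n::nat) (A::nat \<Rightarrow> real) B. (\<forall>i<n. A i \<le> B i \<and> {A i..B i} \<subseteq> {a..b}) \<longrightarrow>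
      disjoint_family_on (\<lambda>i. {A i<..<B i}) {..<n} \<longrightarrow> (\<Sum>i<n. B i - A i) < \<delta> \<longrightarrow>
      (\<Sum>i<n. \<bar>h (B i) - h (A i)\<bar>) < \<epsilon>"
  proof (intro exI[of _ \<delta>] conjI allI impI \<delta>)
    fix n :: nat and A B :: "nat \<Rightarrow> real"
    assume "\<forall>i<n. A i \<le> B i \<and> {A i..B i} \<subseteq> {a..b}" "disjoint_family_on (\<lambda>i. {A i<..<B i}) {..<n}"
      "(\<Sum>i<n. B i - A i) < \<delta>"
    then show "(\<Sum>i<n. \<bar>h (B i) - h (A i)\<bar>) < \<epsilon>" using key by simp
  qed
qed

text \<open>Unlike absolute continuity, this condition makes closure under sums and products
  immediate.\<close>

definition dominated_on :: "real set \<Rightarrow> (real \<Rightarrow> real) \<Rightarrow> (real \<Rightarrow> real) \<Rightarrow> bool" where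
  "dominated_on S w h \<longleftrightarrow> (\<exists>C\<ge>0. \<forall>x\<in>S. \<forall>y\<in>S. x \<le> y \<longrightarrow>
     \<bar>h y - h x\<bar> \<le> C * (\<integral>u. indicator {x..y} u * w u \<partial>lborel))"

lemma dominated_onI:
  assumes "C \<ge> 0" "\<And>x y. x \<in> S \<Longrightarrow> y \<in> S \<Longrightarrow> x \<le> y \<Longrightarrow>
    \<bar>h y - h x\<bar> \<le> C * (\<integral>u. indicator {x..y} u * w u \<partial>lborel)"
  shows "dominated_on S w h"
  using assms unfolding dominated_on_def by blast

lemma dominated_on_cmult:
  assumes "dominated_on S w h"
  shows "dominated_on S w (\<lambda>x. c * h x)"
proof -
  obtain C where C: "C \<ge> 0" "\<And>x y. x \<in> S \<Longrightarrow> y \<in> S \<Longrightarrow> x \<le> y \<Longrightarrow>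
      \<bar>h y - h x\<bar> \<le> C * (\<integral>u. indicator {x..y} u * w u \<partial>lborel)"
    using assms unfolding dominated_on_def by blast
  show ?thesis
  proof (rule dominated_onI)
    show "\<bar>c\<bar> * C \<ge> 0" using C(1) by simp
    show "\<bar>c * h y - c * h x\<bar> \<le> (\<bar>c\<bar> * C) * (\<integral>u. indicator {x..y} u * w u \<partial>lborel)"
      if "x \<in> S" "y \<in> S" "x \<le> y" for x y
      using mult_left_mono[OF C(2)[OF that], of "\<bar>c\<bar>"]
      unfolding right_diff_distrib[symmetric] abs_mult mult.assoc by simp
  qed
qed

lemma dominated_on_add:
  assumes "dominated_on S w h" "dominated_on S w k"
  shows "dominated_on S w (\<lambda>x. h x + k x)"
proof -
  obtain C where C: "C \<ge> 0" "\<And>x y. x \<in> S \<Longrightarrow> y \<in> S \<Longrightarrow> x \<le> y \<Longrightarrow>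
      \<bar>h y - h x\<bar> \<le> C * (\<integral>u. indicator {x..y} u * w u \<partial>lborel)"
    using assms(1) unfolding dominated_on_def by blast
  obtain D where D: "D \<ge> 0" "\<And>x y. x \<in> S \<Longrightarrow> y \<in> S \<Longrightarrow> x \<le> y \<Longrightarrow>
      \<bar>k y - k x\<bar> \<le> D * (\<integral>u. indicator {x..y} u * w u \<partial>lborel)"
    using assms(2) unfolding dominated_on_def by blast
  show ?thesis
  proof (rule dominated_onI)
    show "C + D \<ge> 0" using C(1) D(1) by simp
    show "\<bar>(h y + k y) - (h x + k x)\<bar> \<le> (C + D) * (\<integral>u. indicator {x..y} u * w u \<partial>lborel)"
      if "x \<in> S" "y \<in> S" "x \<le> y" for x y
      using C(2)[OF that] D(2)[OF that] unfolding distrib_right by linarith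
  qed
qed

lemma dominated_on_sum:
  assumes "finite I" "\<And>i. i \<in> I \<Longrightarrow> dominated_on S w (h i)"
  shows "dominated_on S w (\<lambda>x. \<Sum>i\<in>I. h i x)"
  using assms
proof (induction I rule: finite_induct)
  case empty
  show ?case by (rule dominated_onI[of 0]) auto
next
  case (insert i I)
  then show ?case by (simp add: dominated_on_add)
qed

lemma dominated_on_mult:
  assumes "dominated_on S w h" "dominated_on S w k"
    and bd: "\<And>x. x \<in> S \<Longrightarrow> \<bar>h x\<bar> \<le> M" "\<And>x. x \<in> S \<Longrightarrow> \<bar>k x\<bar> \<le> M" and M: "M \<ge> 0"
  shows "dominated_on S w (\<lambda>x. h x * k x)"
proof -
  obtain C where C: "C \<ge> 0" "\<And>x y. x \<in> S \<Longrightarrow> y \<in> S \<Longrightarrow> x \<le> y \<Longrightarrow>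
      \<bar>h y - h x\<bar> \<le> C * (\<integral>u. indicator {x..y} u * w u \<partial>lborel)"
    using assms(1) unfolding dominated_on_def by blast
  obtain D where D: "D \<ge> 0" "\<And>x y. x \<in> S \<Longrightarrow> y \<in> S \<Longrightarrow> x \<le> y \<Longrightarrow>
      \<bar>k y - k x\<bar> \<le> D * (\<integral>u. indicator {x..y} u * w u \<partial>lborel)"
    using assms(2) unfolding dominated_on_def by blast
  show ?thesis
  proof (rule dominated_onI)
    show "M * (C + D) \<ge> 0" using C(1) D(1) M by simp
    fix x y assume xy: "x \<in> S" "y \<in> S" "x \<le> y"
    let ?W = "\<integral>u. indicator {x..y} u * w u \<partial>lborel"
    have "h y * k y - h x * k x = h y * (k y - k x) + k x * (h y - h x)" by algebra
    then have "\<bar>h y * k y - h x * k x\<bar> \<le> \<bar>h y\<bar> * \<bar>k y - k x\<bar> + \<bar>k x\<bar> * \<bar>h y - h x\<bar>"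
      by (metis abs_mult abs_triangle_ineq)
    moreover have "\<bar>h y\<bar> * \<bar>k y - k x\<bar> \<le> M * (D * ?W)"
      by (rule mult_mono[OF bd(1)[OF xy(2)] D(2)[OF xy] M]) simp
    moreover have "\<bar>k x\<bar> * \<bar>h y - h x\<bar> \<le> M * (C * ?W)"
      by (rule mult_mono[OF bd(2)[OF xy(1)] C(2)[OF xy] M]) simp
    moreover have "M * (C + D) * ?W = M * (D * ?W) + M * (C * ?W)" by algebra
    ultimately show "\<bar>h y * k y - h x * k x\<bar> \<le> M * (C + D) * ?W" by linarith
  qed
qed

section \<open>Functions dominated by the weight \<open>1 + \<bar>g\<bar>\<close>\<close>

lemma loc_integrable_integrable_Icc:
  assumes "loc_integrable g" "0 \<le> x"
  shows "integrable lborel (\<lambda>u. indicator {x..y} u * g u)"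
    and "integrable lborel (\<lambda>u. indicator {x..y} u * (1 + \<bar>g u\<bar>))"
proof -
  have "integrable lborel (\<lambda>u. indicator {x..y} u *\<^sub>R (indicator {0..y} u * g u))"
    using assms by (intro integrable_mult_indicator) (auto simp: loc_integrable_def)
  also have "(\<lambda>u. indicator {x..y} u *\<^sub>R (indicator {0..y} u * g u)) = (\<lambda>u. indicator {x..y} u * g u)"
    using assms by (auto simp: fun_eq_iff indicator_def)
  finally show 1: "integrable lborel (\<lambda>u. indicator {x..y} u * g u)" .
  have "integrable lborel (\<lambda>u. indicator {x..y} u + \<bar>indicator {x..y} u * g u\<bar>)"
    using 1 by (intro Bochner_Integration.integrable_add integrable_abs) (auto simp: integrable_indicator_iff emeasure_lborel_Icc_eq)
  also have "(\<lambda>u. indicator {x..y} u + \<bar>indicator {x..y} u * g u\<bar>) = (\<lambda>u. indicator {x..y} u * (1 + \<bar>g u\<bar>))"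
    by (auto simp: fun_eq_iff indicator_def)
  finally show "integrable lborel (\<lambda>u. indicator {x..y} u * (1 + \<bar>g u\<bar>))" .
qed

text \<open>The summand 1 makes the integral of the weight over \<open>{x..y}\<close> at least
  \<open>y - x\<close>, so a Lipschitz bound is a domination bound; the Lipschitz constant is the
  maximum of the continuous derivative on a compact interval.\<close>

lemma dominated_on_C1:
  assumes g: "loc_integrable g" and a: "0 < a"
    and deriv: "\<And>x. x \<in> {a..b} \<Longrightarrow> (h has_real_derivative h' x) (at x)"
    and cont: "continuous_on {a..b} h'"
  shows "dominated_on {a..b} (\<lambda>u. 1 + \<bar>g u\<bar>) h"
proof -
  have "bounded (h' ` {a..b})"
    by (rule compact_imp_bounded[OF compact_continuous_image[OF cont compact_Icc]])
  then obtain B where B0: "B > 0" "\<forall>y\<in>h' ` {a..b}. norm y \<le> B"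
    unfolding bounded_pos by (elim exE conjE)
  have B: "\<bar>h' x\<bar> \<le> B" if "x \<in> {a..b}" for x
    using bspec[OF B0(2) imageI[OF that]] by simp
  show ?thesis
  proof (rule dominated_onI[of B])
    show "\<bar>h y - h x\<bar> \<le> B * (\<integral>u. indicator {x..y} u * (1 + \<bar>g u\<bar>) \<partial>lborel)"
      if "x \<in> {a..b}" "y \<in> {a..b}" "x \<le> y" for x y
    proof -
      have 1: "norm (h y - h x) \<le> B * norm (y - x)"
        by (rule field_differentiable_bound[where S = "{a..b}" and f = h and f' = h' and B = B and x = y and y = x,
              OF convex_real_interval(5) has_field_derivative_at_within[OF deriv]])
          (use B that in simp_all)
      have "norm (y - x) = (\<integral>u. indicator {x..y} u \<partial>lborel)" using that by simp
      also have "\<dots> \<le> (\<integral>u. indicator {x..y} u * (1 + \<bar>g u\<bar>) \<partial>lborel)"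
      proof (rule integral_mono)
        show "integrable lborel (\<lambda>u. indicator {x..y} u * (1 + \<bar>g u\<bar>))"
          using that a by (intro loc_integrable_integrable_Icc g) auto
        show "integrable lborel (\<lambda>u. indicator {x..y} u :: real)"
          by (simp add: integrable_indicator_iff emeasure_lborel_Icc_eq)
        show "indicator {x..y} u \<le> indicator {x..y} u * (1 + \<bar>g u\<bar>)" for u
          by (simp add: indicator_def)
      qed
      finally have "B * norm (y - x) \<le> B * (\<integral>u. indicator {x..y} u * (1 + \<bar>g u\<bar>) \<partial>lborel)"
        using B0(1) by (intro mult_left_mono) auto
      with 1 show ?thesis by (simp only: real_norm_def)
    qed
  qed (use B0(1) in simp)
qed

text \<open>This mean need not be differentiable. It is a product of \<open>abel_int g 0\<close>,
  the indefinite integral of \<open>g\<close>, whose increments are bounded by integrals of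
  \<open>\<bar>g\<bar>\<close>, and the smooth factor \<open>1 / s ^ Suc n\<close>.\<close>

lemma dominated_on_slice_mean_0_over_power:
  assumes g: "loc_integrable g" and a: "0 < a"
  shows "dominated_on {a..b} (\<lambda>u. 1 + \<bar>g u\<bar>) (\<lambda>s. slice_mean g 0 s / s ^ n)"
proof -
  let ?P = "abel_int g 0"
  \<comment> \<open>On \<open>{0..x}\<close> the factor
    \<open>(x\<^sup>2 - u\<^sup>2) powr 0\<close> is 1 except at \<open>u = x\<close>, where
    \<open>0 powr 0 = 0\<close>.\<close>
  have P: "?P x = (\<integral>u. indicator {0..x} u * g u \<partial>lborel)" if "x \<ge> 0" for x
    unfolding abel_int_def
  proof (rule integral_cong_AE)
    show "AE u in lborel. indicator {0..x} u * (g u * (x\<^sup>2 - u\<^sup>2) powr 0) = indicator {0..x} u * g u"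
      using AE_lborel_singleton[of x]
      by eventually_elim (auto simp: indicator_def powr_def power2_eq_iff_nonneg)
  qed (use g in \<open>auto simp: loc_integrable_def\<close>)
  have Pd: "\<bar>?P y - ?P x\<bar> \<le> 1 * (\<integral>u. indicator {x..y} u * (1 + \<bar>g u\<bar>) \<partial>lborel)"
    if "x \<in> {a..b}" "y \<in> {a..b}" "x \<le> y" for x y
  proof -
    have x: "0 \<le> x" "0 \<le> y" using that a by auto
    have eq: "?P y - ?P x = (\<integral>u. indicator {0..y} u * g u - indicator {0..x} u * g u \<partial>lborel)"
      using g x by (simp add: P Bochner_Integration.integral_diff loc_integrable_def)
    show ?thesis unfolding eq mult_1
    proof (rule order.trans[OF integral_abs_bound], rule integral_mono)
      show "integrable lborel (\<lambda>u. \<bar>indicator {0..y} u * g u - indicator {0..x} u * g u\<bar>)"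
        using g by (auto simp: loc_integrable_def)
      show "integrable lborel (\<lambda>u. indicator {x..y} u * (1 + \<bar>g u\<bar>))"
        by (rule loc_integrable_integrable_Icc(2)[OF g x(1)])
      show "\<bar>indicator {0..y} u * g u - indicator {0..x} u * g u\<bar> \<le> indicator {x..y} u * (1 + \<bar>g u\<bar>)" for u
        using that x by (auto simp: indicator_def)
    qed
  qed
  have dP: "dominated_on {a..b} (\<lambda>u. 1 + \<bar>g u\<bar>) ?P"
    using Pd by (intro dominated_onI[of 1]) simp_all
  have "continuous_on {a..b} (slice_mean g 0)"
    by (rule continuous_on_subset[OF continuous_on_slice_mean_nonneg[OF g]]) (use a in auto)
  then have "continuous_on {a..b} (\<lambda>s. s powr (2 * 0 + 1) * slice_mean g 0 s)"
    using a by (intro continuous_intros) auto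
  then have "continuous_on {a..b} ?P"
    by (rule continuous_on_eq) (use a in \<open>auto simp: abel_int_eq_slice_mean\<close>)
  then have "bounded (?P ` {a..b})"
    by (rule compact_imp_bounded[OF compact_continuous_image[OF _ compact_Icc]])
  then obtain M1 where "\<forall>y\<in>?P ` {a..b}. norm y \<le> M1" unfolding bounded_iff by (elim exE)
  then have M1: "\<bar>?P x\<bar> \<le> M1" if "x \<in> {a..b}" for x
    using that by simp
  have "continuous_on {a..b} (\<lambda>s. 1 / s ^ Suc n)" using a by (intro continuous_intros) auto
  then have "bounded ((\<lambda>s. 1 / s ^ Suc n) ` {a..b})"
    by (rule compact_imp_bounded[OF compact_continuous_image[OF _ compact_Icc]])
  then obtain M2 where M2pos: "M2 > 0" and "\<forall>y\<in>(\<lambda>s. 1 / s ^ Suc n) ` {a..b}. norm y \<le> M2"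
    unfolding bounded_pos by (elim exE conjE)
  then have M2: "\<bar>1 / x ^ Suc n\<bar> \<le> M2" if "x \<in> {a..b}" for x
    using that by (simp del: power_Suc)
  have dp: "dominated_on {a..b} (\<lambda>u. 1 + \<bar>g u\<bar>) (\<lambda>s. 1 / s ^ Suc n)"
  proof (rule dominated_on_C1[OF g a])
    fix x assume x: "x \<in> {a..b}"
    show "((\<lambda>s. 1 / s ^ Suc n) has_real_derivative - (real (Suc n) * x ^ n) / (x ^ Suc n * x ^ Suc n)) (at x)"
      using x a by (auto intro!: derivative_eq_intros simp del: power_Suc)
  qed (use a in \<open>intro continuous_intros; auto\<close>)
  have "dominated_on {a..b} (\<lambda>u. 1 + \<bar>g u\<bar>) (\<lambda>s. ?P s * (1 / s ^ Suc n))"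
  proof (rule dominated_on_mult[OF dP dp, where M = "max M1 M2"])
    show "\<bar>?P x\<bar> \<le> max M1 M2" "\<bar>1 / x ^ Suc n\<bar> \<le> max M1 M2" if "x \<in> {a..b}" for x
      using M1[OF that] M2[OF that] by linarith+
  qed (use M2pos in simp)
  moreover have "?P s * (1 / s ^ Suc n) = slice_mean g 0 s / s ^ n" if "s \<in> {a..b}" for s
    using that a by (simp add: abel_int_eq_slice_mean)
  ultimately show ?thesis unfolding dominated_on_def by simp
qed

text \<open>The case of odd dimension, with \<open>\<alpha> = n\<close>. In the formula for the
  \<open>n\<close>-th derivative the terms with \<open>i < n\<close> are continuously
  differentiable, and the term \<open>i = n\<close> is a mean of \<open>g\<close> itself; both kinds
  are dominated by \<open>1 + \<bar>g\<bar>\<close>.\<close>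

lemma absolutely_continuous_on_iterated_deriv_slice_mean:
  assumes g: "loc_integrable g" and F: "\<And>s. s > 0 \<Longrightarrow> F s = C * slice_mean g (real n) s" and a: "0 < a"
  shows "absolutely_continuous_on {a..b} ((deriv ^^ n) F)"
proof -
  have cont: "continuous_on {0<..} (slice_mean g (real n - real i))" if "i \<le> n" for i
    using that by (intro continuous_on_slice_mean_nonneg g) auto
  have "\<exists>c. c n = C * (\<Prod>i<n. 2 * (real n - real i)) \<and>
    (\<forall>s>0. (deriv ^^ n) F s = (\<Sum>i\<le>n. c i * (slice_mean g (real n - real i) s / s ^ n)))"
    by (intro iterated_deriv_slice_mean g F cont) auto
  then obtain c where c: "\<And>s. s > 0 \<Longrightarrow> (deriv ^^ n) F s = (\<Sum>i\<le>n. c i * (slice_mean g (real n - real i) s / s ^ n))"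
    by blast
  have "dominated_on {a..b} (\<lambda>u. 1 + \<bar>g u\<bar>) (\<lambda>s. \<Sum>i\<le>n. c i * (slice_mean g (real n - real i) s / s ^ n))"
  proof (intro dominated_on_sum dominated_on_cmult)
    fix i assume "i \<in> {..n}"
    show "dominated_on {a..b} (\<lambda>u. 1 + \<bar>g u\<bar>) (\<lambda>s. slice_mean g (real n - real i) s / s ^ n)"
    proof (cases "i = n")
      case True
      then show ?thesis using dominated_on_slice_mean_0_over_power[OF g a] by simp
    next
      case False
      then have i: "i < n" using \<open>i \<in> {..n}\<close> by auto
      let ?\<alpha> = "real n - real i"
      have c1: "continuous_on {0<..} (slice_mean g (?\<alpha> - 1))"
        using cont[of "Suc i"] i by (simp add: diff_diff_eq add.commute)
      show ?thesis
      proof (rule dominated_on_C1[OF g a])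
        fix x assume "x \<in> {a..b}"
        then show "((\<lambda>s. slice_mean g ?\<alpha> s / s ^ n) has_real_derivative
            (2 * ?\<alpha> * slice_mean g (?\<alpha> - 1) x - (2 * ?\<alpha> + 1 + real n) * slice_mean g ?\<alpha> x) / x ^ Suc n) (at x)"
          using a i by (intro has_real_derivative_slice_mean_over_power g c1) auto
      next
        have "continuous_on {0<..} (\<lambda>x. (2 * ?\<alpha> * slice_mean g (?\<alpha> - 1) x - (2 * ?\<alpha> + 1 + real n) * slice_mean g ?\<alpha> x) / x ^ Suc n)"
          using c1 cont[of i] i by (intro continuous_intros) auto
        then show "continuous_on {a..b} (\<lambda>x. (2 * ?\<alpha> * slice_mean g (?\<alpha> - 1) x - (2 * ?\<alpha> + 1 + real n) * slice_mean g ?\<alpha> x) / x ^ Suc n)"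
          by (rule continuous_on_subset) (use a in auto)
      qed
    qed
  qed auto
  then obtain K where K: "K \<ge> 0" "\<And>x y. x \<in> {a..b} \<Longrightarrow> y \<in> {a..b} \<Longrightarrow> x \<le> y \<Longrightarrow>
      \<bar>(\<Sum>i\<le>n. c i * (slice_mean g (real n - real i) y / y ^ n)) - (\<Sum>i\<le>n. c i * (slice_mean g (real n - real i) x / x ^ n))\<bar>
      \<le> K * (\<integral>u. indicator {x..y} u * (1 + \<bar>g u\<bar>) \<partial>lborel)"
    unfolding dominated_on_def by blast
  show ?thesis
  proof (rule absolutely_continuous_on_dominated)
    show "integrable lborel (\<lambda>u. indicator {a..b} u * (K * (1 + \<bar>g u\<bar>)))"
      using integrable_mult_right[OF loc_integrable_integrable_Icc(2)[OF g, of a b], of K] a by (simp add: mult.left_commute)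
    fix x y assume xy: "a \<le> x" "x \<le> y" "y \<le> b"
    then have "\<bar>(deriv ^^ n) F y - (deriv ^^ n) F x\<bar> \<le> K * (\<integral>u. indicator {x..y} u * (1 + \<bar>g u\<bar>) \<partial>lborel)"
      using K(2)[of x y] a c by auto
    also have "\<dots> = (\<integral>u. indicator {x..y} u * (K * (1 + \<bar>g u\<bar>)) \<partial>lborel)"
      by (subst integral_mult_right_zero[symmetric]) (simp only: mult.left_commute)
    finally show "\<bar>(deriv ^^ n) F y - (deriv ^^ n) F x\<bar> \<le> (\<integral>u. indicator {x..y} u * (K * (1 + \<bar>g u\<bar>)) \<partial>lborel)" .
  qed (use K in auto)
qed

subsection \<open>Optimality\<close>

text \<open>The derivative at \<open>1\<close> would be nonnegative because the function is constant on \<open>{0<..1}\<close>,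
  and at most \<open>-1\<close> because of the decay on the right.\<close>

lemma not_differentiable_slice_mean_indicator:
  assumes \<beta>: "-1 < \<beta>" "\<beta> \<le> 0"
  shows "\<not> slice_mean (indicator {0..1}) \<beta> field_differentiable (at 1)"
proof
  define k where "k t = (1 - t\<^sup>2) powr \<beta>" for t :: real
  define J where "J = slice_mean (indicator {0..1}) \<beta>"
  have J: "J s = (\<integral>u. indicator {0..s} u * (indicator {0..1} u * k (u / s)) \<partial>lborel) / s" for s
    by (simp add: J_def slice_mean_def kernel_mean_def k_def)
  have ki: "integrable lborel (\<lambda>t. indicator {0..1} t * k t)"
    unfolding k_def by (rule integrable_one_minus_square_powr[OF \<beta>])
  have le1: "J s = (\<integral>t. indicator {0..1} t * k t \<partial>lborel)" if "0 < s" "s \<le> 1" for s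
  proof -
    have "(\<lambda>u. indicator {0..s} u * (indicator {0..1} u * k (u / s))) = (\<lambda>u. indicator {0..s} u * k (u / s))"
      using that by (auto simp: fun_eq_iff indicator_def)
    then show ?thesis unfolding J using integral_scaled_kernel[OF that(1), of k] that by simp
  qed
  \<comment> \<open>For \<open>s > 1\<close> only \<open>t \<le> 1 / s\<close> contributes. The mass
    lost lies on the interval from \<open>1 / s\<close> to 1, where \<open>k \<ge> 1\<close> because
    \<open>\<beta> \<le> 0\<close>.\<close>
  have ge1: "J s \<le> J 1 - (1 - 1 / s)" if s: "1 < s" for s
  proof -
    define h where "h t = indicator {0..1/s} t * k t" for t
    have "(\<lambda>u. indicator {0..s} u * (indicator {0..1} u * k (u / s))) = (\<lambda>u. indicator {0..s} u * h (u / s))"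
      using s by (auto simp: fun_eq_iff indicator_def h_def field_simps)
    then have Js: "J s = (\<integral>t. indicator {0..1} t * h t \<partial>lborel)"
      unfolding J using integral_scaled_kernel[of s h] s by simp
    have s1: "1 / s \<le> 1" using s by simp
    have hi: "integrable lborel (\<lambda>t. indicator {0..1} t * h t)"
    proof -
      have "(\<lambda>t. indicator {0..1} t * h t) = (\<lambda>t. indicator {0..1/s} t *\<^sub>R (indicator {0..1} t * k t))"
        by (auto simp: fun_eq_iff indicator_def h_def)
      then show ?thesis using integrable_mult_indicator[OF _ ki, of "{0..1/s}"] by simp
    qed
    have I: "integrable lborel (indicator {1/s<..<1} :: real \<Rightarrow> real)"
      using s1 by (simp add: integrable_indicator_iff)
    have "1 - 1 / s = (\<integral>t. indicator {1/s<..<1} t \<partial>lborel)" using s1 by simp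
    also have "\<dots> \<le> (\<integral>t. indicator {0..1} t * k t - indicator {0..1} t * h t \<partial>lborel)"
    proof (rule integral_mono[OF I Bochner_Integration.integrable_diff[OF ki hi]])
      fix t :: real
      show "indicator {1/s<..<1} t \<le> indicator {0..1} t * k t - indicator {0..1} t * h t"
      proof (cases "t \<in> {1/s<..<1}")
        case True
        then have "1 / s < t" "t < 1" by auto
        moreover have "0 < 1 / s" using s by simp
        ultimately have t: "0 < t" "t < 1" by linarith+
        then have "t\<^sup>2 < 1" by (simp add: abs_square_less_1)
        then have "1 powr \<beta> \<le> k t" unfolding k_def using \<beta> by (intro powr_mono2') auto
        then show ?thesis using True t by (simp add: h_def)
      next
        case False
        have "0 \<le> k t" by (simp add: k_def)
        then show ?thesis using False by (auto simp: h_def indicator_def)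
      qed
    qed
    also have "\<dots> = J 1 - J s"
      unfolding Js le1[OF zero_less_one order_refl] using ki hi by (rule Bochner_Integration.integral_diff)
    finally show ?thesis by simp
  qed
  assume "slice_mean (indicator {0..1}) \<beta> field_differentiable (at 1)"
  then obtain D where D: "(J has_real_derivative D) (at 1)"
    by (auto simp: field_differentiable_def J_def)
  \<comment> \<open>A negative derivative would make \<open>J\<close> strictly larger just to the
    left of 1, where it is constant.\<close>
  have "D \<ge> 0"
  proof (rule ccontr)
    assume "\<not> D \<ge> 0"
    then obtain e where e: "e > 0" "\<And>h. 0 < h \<Longrightarrow> h < e \<Longrightarrow> J 1 < J (1 - h)"
      using DERIV_neg_dec_left[OF D] by auto
    define h where "h = min (e / 2) (1 / 2)"
    have "0 < h" "h < e" "h < 1" using e(1) by (auto simp: h_def)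
    then show False using e(2)[of h] le1[of 1] le1[of "1 - h"] by simp
  qed
  \<comment> \<open>The positive derivative \<open>D + 1\<close> forces \<open>J s - 1 / s\<close>
    above \<open>J 1 - 1\<close> just to the right of 1, whereas \<open>ge1\<close> says that it is
    at most \<open>J 1 - 1\<close> there.\<close>
  moreover have "((\<lambda>s. J s - 1 / s) has_real_derivative D + 1) (at 1)"
    using D by (auto intro!: derivative_eq_intros)
  ultimately obtain e where e: "e > 0" "\<And>h. 0 < h \<Longrightarrow> h < e \<Longrightarrow> J 1 - 1 / 1 < J (1 + h) - 1 / (1 + h)"
    using DERIV_pos_inc_right[of "\<lambda>s. J s - 1 / s" "D + 1" 1] by auto
  show False using e(2)[of "e / 2"] e(1) ge1[of "1 + e / 2"] by simp
qed

text \<open>The formula for the \<open>n\<close>-th derivative is solved for its last mean. All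
  other means are differentiable at \<open>x\<close>, and the leading coefficient is nonzero because
  \<open>C \<noteq> 0\<close> and \<open>\<alpha> - i > 0\<close> for \<open>i < n\<close>; so one
  more derivative of \<open>F\<close> would make the last mean differentiable at
  \<open>x\<close>.\<close>

lemma not_times_differentiable_on_slice_mean:
  fixes \<alpha> :: real
  assumes g: "loc_integrable g" and F: "\<And>s. s > 0 \<Longrightarrow> F s = C * slice_mean g \<alpha> s" and C: "C \<noteq> 0"
    and pos: "\<And>i. i < n \<Longrightarrow> real i < \<alpha>"
    and cont: "\<And>i. i \<le> n \<Longrightarrow> continuous_on {0<..} (slice_mean g (\<alpha> - real i))"
    and nd: "\<not> slice_mean g (\<alpha> - real n) field_differentiable (at x)" and x: "x > 0"
  shows "\<not> times_differentiable_on (Suc n) F {0<..}"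
proof
  assume "times_differentiable_on (Suc n) F {0<..}"
  then obtain D where D: "((deriv ^^ n) F has_real_derivative D) (at x)"
    using x by (auto simp: times_differentiable_on_def field_differentiable_def)
  have "\<exists>c. c n = C * (\<Prod>i<n. 2 * (\<alpha> - real i)) \<and>
    (\<forall>s>0. (deriv ^^ n) F s = (\<Sum>i\<le>n. c i * (slice_mean g (\<alpha> - real i) s / s ^ n)))"
    by (intro iterated_deriv_slice_mean g F pos cont) auto
  then obtain c where cn: "c n = C * (\<Prod>i<n. 2 * (\<alpha> - real i))"
    and c: "\<And>s. s > 0 \<Longrightarrow> (deriv ^^ n) F s = (\<Sum>i\<le>n. c i * (slice_mean g (\<alpha> - real i) s / s ^ n))"
    by blast
  have c0: "c n \<noteq> 0" using pos C by (auto simp: cn)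
  define E where "E = (\<Sum>i<n. c i * ((2 * (\<alpha> - real i) * slice_mean g (\<alpha> - real i - 1) x
          - (2 * (\<alpha> - real i) + 1 + real n) * slice_mean g (\<alpha> - real i) x) / x ^ Suc n))"
  have "((\<lambda>s. \<Sum>i<n. c i * (slice_mean g (\<alpha> - real i) s / s ^ n)) has_real_derivative E) (at x)"
    unfolding E_def using pos cont[of "Suc _"] x
    by (intro DERIV_sum DERIV_cmult has_real_derivative_slice_mean_over_power g) (auto simp: diff_diff_eq add.commute)
  from DERIV_diff[OF D this]
  have "((\<lambda>s. s ^ n / c n * ((deriv ^^ n) F s - (\<Sum>i<n. c i * (slice_mean g (\<alpha> - real i) s / s ^ n))))
      has_real_derivative (real n * x ^ (n - 1) / c n) * ((deriv ^^ n) F x - (\<Sum>i<n. c i * (slice_mean g (\<alpha> - real i) x / x ^ n)))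
        + (D - E) * (x ^ n / c n)) (at x)"
    using c0 by (intro DERIV_mult) (auto intro!: derivative_eq_intros)
  then have "(slice_mean g (\<alpha> - real n) has_real_derivative
      (real n * x ^ (n - 1) / c n) * ((deriv ^^ n) F x - (\<Sum>i<n. c i * (slice_mean g (\<alpha> - real i) x / x ^ n)))
        + (D - E) * (x ^ n / c n)) (at x)"
  proof (rule has_field_derivative_transform_within_open[where S = "{0<..}"])
    fix s :: real assume "s \<in> {0<..}"
    then show "s ^ n / c n * ((deriv ^^ n) F s - (\<Sum>i<n. c i * (slice_mean g (\<alpha> - real i) s / s ^ n)))
        = slice_mean g (\<alpha> - real n) s"
      using c0 by (simp add: c lessThan_Suc_atMost[symmetric])
  qed (use x in auto)
  then show False using nd by (auto simp: field_differentiable_def)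
qed

subsection \<open>The slicing transform\<close>

lemma slicing_integral_scale:
  fixes f :: "real \<Rightarrow> real"
  assumes "s > 0"
  shows "(LINT t:{0..1}|lebesgue. f (t * s) * (1 - t\<^sup>2) powr \<beta>) =
    (1 / s) * (LINT t:{0..s}|lebesgue. f t * (1 - t\<^sup>2 / s\<^sup>2) powr \<beta>)"
proof -
  have "(LINT t:{0..s}|lebesgue. f t * (1 - t\<^sup>2 / s\<^sup>2) powr \<beta>)
     = \<bar>s\<bar> *\<^sub>R (\<integral>t. indicator {0..s} (0 + s * t) *\<^sub>R (f (0 + s * t) * (1 - (0 + s * t)\<^sup>2 / s\<^sup>2) powr \<beta>) \<partial>lebesgue)"
    unfolding set_lebesgue_integral_def using assms by (intro lebesgue_integral_real_affine) auto
  also have "(\<lambda>t. indicator {0..s} (0 + s * t) *\<^sub>R (f (0 + s * t) * (1 - (0 + s * t)\<^sup>2 / s\<^sup>2) powr \<beta>))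
     = (\<lambda>t. indicator {0..1} t *\<^sub>R (f (t * s) * (1 - t\<^sup>2) powr \<beta>))"
    using assms by (auto simp: fun_eq_iff indicator_def power_mult_distrib zero_le_mult_iff mult.commute)
  finally show ?thesis using assms by (simp add: set_lebesgue_integral_def)
qed

lemma slicing_transform_eq_slice_mean:
  assumes f: "set_borel_measurable lebesgue {0..} f"
    and g[measurable]: "g \<in> borel_measurable borel"
    and fg: "AE u in lborel. 0 \<le> u \<longrightarrow> f u = g u" and s: "s > 0"
  shows "slicing_transform d f s = slicing_const d * slice_mean g ((real d - 3) / 2) s"
proof -
  define \<beta> where "\<beta> = (real d - 3) / 2"
  define r where "r u = indicator {0..s} u * (g u * (1 - (u / s)\<^sup>2) powr \<beta>)" for u
  have rm: "r \<in> borel_measurable borel" unfolding r_def by measurable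
  have "(LINT t:{0..s}|lebesgue. f t * (1 - t\<^sup>2 / s\<^sup>2) powr \<beta>) = integral\<^sup>L lebesgue r"
    unfolding set_lebesgue_integral_def
  proof (rule integral_cong_AE)
    have [measurable]: "(\<lambda>t. indicator {0..} t *\<^sub>R f t) \<in> borel_measurable lebesgue"
      using f by (simp add: set_borel_measurable_def)
    have "(\<lambda>t. indicator {0..s} t * (1 - t\<^sup>2 / s\<^sup>2) powr \<beta>) \<in> borel_measurable lborel"
      by measurable
    then have [measurable]: "(\<lambda>t. indicator {0..s} t * (1 - t\<^sup>2 / s\<^sup>2) powr \<beta>) \<in> borel_measurable lebesgue"
      by (rule measurable_completion)
    \<comment> \<open>Measurability of \<open>f\<close> is known only after multiplication by the
      indicator of \<open>{0..}\<close>, so the integrand is regrouped to contain this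
      product.\<close>
    have "(\<lambda>t. (indicator {0..} t *\<^sub>R f t) * (indicator {0..s} t * (1 - t\<^sup>2 / s\<^sup>2) powr \<beta>)) \<in> borel_measurable lebesgue"
      by measurable
    also have "(\<lambda>t. (indicator {0..} t *\<^sub>R f t) * (indicator {0..s} t * (1 - t\<^sup>2 / s\<^sup>2) powr \<beta>))
      = (\<lambda>t. indicator {0..s} t *\<^sub>R (f t * (1 - t\<^sup>2 / s\<^sup>2) powr \<beta>))"
      by (auto simp: fun_eq_iff indicator_def)
    finally show "(\<lambda>t. indicator {0..s} t *\<^sub>R (f t * (1 - t\<^sup>2 / s\<^sup>2) powr \<beta>)) \<in> borel_measurable lebesgue" .
    show "r \<in> borel_measurable lebesgue" using rm by (intro measurable_completion) simp
    show "AE t in lebesgue. indicator {0..s} t *\<^sub>R (f t * (1 - t\<^sup>2 / s\<^sup>2) powr \<beta>) = r t"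
      using AE_completion[OF fg]
      by eventually_elim (auto simp: r_def indicator_def power_divide)
  qed
  also have "\<dots> = integral\<^sup>L lborel r" using rm by (intro integral_completion) simp
  also have "\<dots> = s * slice_mean g \<beta> s" using s by (simp add: r_def[abs_def] slice_mean_def kernel_mean_def)
  finally show ?thesis
    unfolding slicing_transform_def slicing_integral_scale[OF s] \<beta>_def using s by simp
qed

text \<open>A Lebesgue measurable function agrees almost everywhere with a Borel one. Local
  integrability follows from \<open>\<bar>x\<bar> \<le> 1 + \<bar>x\<bar> powr p\<close> for
  \<open>p \<ge> 1\<close>.\<close>

lemma Lp_loc_borel_version:
  assumes p: "p \<ge> 1" and f: "Lp_loc p f"
  obtains g where "g \<in> borel_measurable borel" "AE u in lborel. 0 \<le> u \<longrightarrow> f u = g u"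
    "\<And>b. integrable lborel (\<lambda>u. indicator {0..b} u * \<bar>g u\<bar> powr p)" "loc_integrable g"
proof -
  have fm: "(\<lambda>t. indicator {0..} t *\<^sub>R f t) \<in> borel_measurable (completion lborel)"
    using f by (simp add: Lp_loc_def set_borel_measurable_def)
  obtain g where g[measurable]: "g \<in> borel_measurable lborel"
      and fg0: "AE u in lborel. indicator {0..} u *\<^sub>R f u = g u"
    using completion_ex_borel_measurable_real[OF fm] by blast
  have gm[measurable]: "g \<in> borel_measurable borel" using g by simp
  have fg: "AE u in lborel. 0 \<le> u \<longrightarrow> f u = g u"
    using fg0 by eventually_elim (auto simp: indicator_def)
  have gp: "integrable lborel (\<lambda>u. indicator {0..b} u * \<bar>g u\<bar> powr p)" for b
  proof -
    \<comment> \<open>\<open>Lp_loc\<close> speaks of positive bounds, while here \<open>b\<close>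
      is arbitrary.\<close>
    define c where "c = max b 1"
    have "integrable lebesgue (\<lambda>u. indicator {0..c} u *\<^sub>R (\<bar>f u\<bar> powr p))"
      using f by (simp add: Lp_loc_def set_integrable_def c_def)
    then have "integrable lebesgue (\<lambda>u. indicator {0..c} u * \<bar>g u\<bar> powr p)"
    proof (rule integrable_cong_AE_imp)
      have "(\<lambda>u. indicator {0..c} u * \<bar>g u\<bar> powr p) \<in> borel_measurable lborel" by measurable
      then show "(\<lambda>u. indicator {0..c} u * \<bar>g u\<bar> powr p) \<in> borel_measurable lebesgue"
        by (rule measurable_completion)
      show "AE u in lebesgue. indicator {0..c} u *\<^sub>R (\<bar>f u\<bar> powr p) = indicator {0..c} u * \<bar>g u\<bar> powr p"
        using AE_completion[OF fg] by eventually_elim (auto simp: indicator_def)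
    qed
    then have 1: "integrable lborel (\<lambda>u. indicator {0..c} u * \<bar>g u\<bar> powr p)"
      by (subst (asm) integrable_completion) auto
    show ?thesis
      by (rule Bochner_Integration.integrable_bound[OF 1]) (auto simp: indicator_def c_def)
  qed
  have "integrable lborel (\<lambda>u. indicator {0..b} u * g u)" for b
  proof (rule Bochner_Integration.integrable_bound)
    show "integrable lborel (\<lambda>u. indicator {0..b} u + indicator {0..b} u * \<bar>g u\<bar> powr p)"
      by (intro Bochner_Integration.integrable_add gp) (simp add: integrable_indicator_iff emeasure_lborel_Icc_eq)
    have "\<bar>x\<bar> \<le> 1 + \<bar>x\<bar> powr p" for x :: real
    proof (cases "\<bar>x\<bar> \<le> 1")
      case False
      then have "\<bar>x\<bar> powr 1 \<le> \<bar>x\<bar> powr p" using p by (intro powr_mono) auto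
      then show ?thesis by simp
    qed (simp add: add_increasing2)
    then show "AE u in lborel. norm (indicator {0..b} u * g u)
        \<le> norm (indicator {0..b} u + indicator {0..b} u * \<bar>g u\<bar> powr p)"
      by (intro AE_I2) (simp add: indicator_def)
  qed measurable
  then have "loc_integrable g" using gm by (simp add: loc_integrable_def)
  then show thesis using that[OF gm fg gp] by blast
qed

lemma slicing_const_pos: "slicing_const d > 0"
  unfolding slicing_const_def unit_sphere_area_def
  by (intro divide_pos_pos mult_pos_pos Gamma_real_pos) auto

theorem theorem2p3:
  fixes d :: nat
  assumes "d \<ge> 3"
  shows "(\<forall>f. (odd d \<longrightarrow> Lp_loc 1 f) \<longrightarrow> (even d \<longrightarrow> (\<exists>p>2. Lp_loc p f)) \<longrightarrow>
            (\<forall>s>0. slicing_transform d f s =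
               slicing_const d * (1 / s) *
                 (LINT t:{0..s}|lebesgue. f t * (1 - t\<^sup>2 / s\<^sup>2) powr ((real d - 3) / 2))) \<and>
            times_continuously_differentiable_on ((d - 2) div 2) (slicing_transform d f) {0<..} \<and>
            (odd d \<longrightarrow> (\<forall>a b. 0 < a \<longrightarrow> a \<le> b \<longrightarrow>
               absolutely_continuous_on {a..b} ((deriv ^^ ((d - 2) div 2)) (slicing_transform d f))))) \<and>
         (\<exists>f. Linf_loc f \<and>
            \<not> times_differentiable_on (d div 2) (slicing_transform d f) {0<..})"
proof -
  \<comment> \<open>The lowest exponent \<open>\<alpha> - m\<close> is 0 for odd \<open>d\<close>
    and \<open>-1/2\<close> for even \<open>d\<close>; hence \<open>\<alpha> - i > 0\<close> for all
    \<open>i < m\<close>.\<close>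
  define m where "m = (d - 2) div 2"
  define \<alpha> where "\<alpha> = (real d - 3) / 2"
  have \<alpha>_odd: "\<alpha> = real m" if "odd d"
  proof -
    from that obtain k where k: "d = 2 * k + 1" by (rule oddE)
    with assms have "k \<ge> 1" "m = k - 1" by (simp_all add: m_def)
    with k show ?thesis by (simp add: \<alpha>_def of_nat_diff)
  qed
  have \<alpha>_even: "\<alpha> = real m - 1 / 2" if "even d"
  proof -
    from that obtain k where k: "d = 2 * k" by (rule evenE)
    with assms have "k \<ge> 2" "m = k - 1" by (simp_all add: m_def)
    with k show ?thesis by (simp add: \<alpha>_def of_nat_diff field_simps)
  qed
  have m_Suc: "d div 2 = Suc m" using assms by (auto simp: m_def)
  have pos: "real i < \<alpha>" if "i < m" for i
    using that \<alpha>_odd \<alpha>_even by (cases "odd d") auto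
  have cont: "continuous_on {0<..} (slice_mean g (\<alpha> - real i))"
    if g: "loc_integrable g" and half: "even d \<Longrightarrow> continuous_on {0<..} (slice_mean g (- 1 / 2))" and i: "i \<le> m" for g i
  proof (cases "even d \<and> i = m")
    case True
    then show ?thesis using half \<alpha>_even by simp
  next
    case False
    then have "\<alpha> - real i \<ge> 0" using i \<alpha>_odd \<alpha>_even by (cases "odd d") auto
    then show ?thesis using g by (rule continuous_on_slice_mean_nonneg[rotated])
  qed

  \<comment> \<open>Regularity of the transform\<close>
  have regular: "(\<forall>s>0. slicing_transform d f s =
               slicing_const d * (1 / s) *
                 (LINT t:{0..s}|lebesgue. f t * (1 - t\<^sup>2 / s\<^sup>2) powr ((real d - 3) / 2))) \<and>
            times_continuously_differentiable_on ((d - 2) div 2) (slicing_transform d f) {0<..} \<and>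
            (odd d \<longrightarrow> (\<forall>a b. 0 < a \<longrightarrow> a \<le> b \<longrightarrow>
               absolutely_continuous_on {a..b} ((deriv ^^ ((d - 2) div 2)) (slicing_transform d f))))"
    if f1: "odd d \<longrightarrow> Lp_loc 1 f" and f2: "even d \<longrightarrow> (\<exists>p>2. Lp_loc p f)" for f
  proof -
    \<comment> \<open>Odd \<open>d\<close> is included with \<open>p = 1\<close>, so that both
      parities share the same representative \<open>g\<close>.\<close>
    obtain p where p: "p \<ge> 1" "even d \<Longrightarrow> p > 2" and fp: "Lp_loc p f"
      using f1 f2 by (cases "even d") force+
    obtain g where gm: "g \<in> borel_measurable borel" and fg: "AE u in lborel. 0 \<le> u \<longrightarrow> f u = g u"
      and gp: "\<And>b. integrable lborel (\<lambda>u. indicator {0..b} u * \<bar>g u\<bar> powr p)" and g: "loc_integrable g"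
      by (rule Lp_loc_borel_version[OF p(1) fp]) blast
    have fm: "set_borel_measurable lebesgue {0..} f" using fp by (simp add: Lp_loc_def)
    have F: "slicing_transform d f s = slicing_const d * slice_mean g \<alpha> s" if "s > 0" for s
      unfolding \<alpha>_def by (rule slicing_transform_eq_slice_mean[OF fm gm fg that])
    have cg: "continuous_on {0<..} (slice_mean g (\<alpha> - real i))" if "i \<le> m" for i
      using that by (intro cont g continuous_on_slice_mean_neg_half[OF g p(2) gp]) auto
    have "slicing_transform d f s = slicing_const d * (1 / s) *
                 (LINT t:{0..s}|lebesgue. f t * (1 - t\<^sup>2 / s\<^sup>2) powr ((real d - 3) / 2))" if "s > 0" for s
      unfolding slicing_transform_def slicing_integral_scale[OF that] by simp
    moreover have "times_continuously_differentiable_on m (slicing_transform d f) {0<..}"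
      by (rule times_continuously_differentiable_on_slice_mean[OF g F pos cg])
    moreover have "absolutely_continuous_on {a..b} ((deriv ^^ m) (slicing_transform d f))"
      if "odd d" "0 < a" for a b
      using F \<alpha>_odd[OF that(1)] by (intro absolutely_continuous_on_iterated_deriv_slice_mean[OF g _ that(2)]) auto
    ultimately show ?thesis by (simp add: m_def)
  qed

  \<comment> \<open>The indicator function of \<open>[0,1]\<close> as the example for
    optimality\<close>
  define g :: "real \<Rightarrow> real" where "g = indicator {0..1}"
  have gm: "g \<in> borel_measurable borel" by (simp add: g_def)
  have gi: "integrable lborel (\<lambda>u. indicator {0..b} u * g u)" for b
  proof -
    have "integrable lborel (\<lambda>u. indicator {0..b} u *\<^sub>R g u)"
      by (rule integrable_mult_indicator) (auto simp: g_def integrable_indicator_iff)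
    then show ?thesis by simp
  qed
  have g: "loc_integrable g" using gm gi by (simp add: loc_integrable_def)
  have "(\<lambda>u. indicator {0..} u *\<^sub>R g u) \<in> borel_measurable lborel" using gm by measurable
  then have gs: "set_borel_measurable lebesgue {0..} g"
    unfolding set_borel_measurable_def by (rule measurable_completion)
  \<comment> \<open>The exponent 3 is a choice of \<open>p > 2\<close>; powers do not change
    \<open>g\<close>, whose values are 0 and 1.\<close>
  have "(\<lambda>u. indicator {0..b} u * \<bar>g u\<bar> powr 3) = (\<lambda>u. indicator {0..b} u * g u)" for b
    by (auto simp: g_def indicator_def fun_eq_iff)
  then have "integrable lborel (\<lambda>u. indicator {0..b} u * \<bar>g u\<bar> powr 3)" for b
    using gi by simp
  then have "continuous_on {0<..} (slice_mean g (- 1 / 2))"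
    by (intro continuous_on_slice_mean_neg_half[OF g, of 3]) auto
  then have cg: "continuous_on {0<..} (slice_mean g (\<alpha> - real i))" if "i \<le> m" for i
    using that by (intro cont g) auto
  have F: "slicing_transform d g s = slicing_const d * slice_mean g \<alpha> s" if "s > 0" for s
    unfolding \<alpha>_def by (rule slicing_transform_eq_slice_mean[OF gs gm _ that]) simp
  have "\<not> slice_mean g (\<alpha> - real m) field_differentiable (at 1)"
    unfolding g_def using \<alpha>_odd \<alpha>_even by (intro not_differentiable_slice_mean_indicator; cases "odd d") auto
  then have "\<not> times_differentiable_on (Suc m) (slicing_transform d g) {0<..}"
    using slicing_const_pos[of d]
    by (intro not_times_differentiable_on_slice_mean[OF g F _ pos cg, where x = 1]) auto
  moreover have "Linf_loc g"
    unfolding Linf_loc_def using gs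
    by (auto simp: g_def bounded_iff indicator_def intro!: exI[of _ 1])
  ultimately show ?thesis using regular unfolding m_Suc by blast
qed

end
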